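(* Let $k\ge1$ and let $\mu$ be a probability measure on $\mathbb{R}^d$ whose mixed moments of all orders up to $k+1$ coincide with those of $\gamma$. Then $$d_{Zol,k}(\mu,\gamma):=\sup\Big\{\int f\,d\mu-\int f\,d\gamma:\ f\in C^k(\mathbb{R}^d),\ \sup_x\|D^kf(x)\|_2\le1\Big\}\le\bar S_k(\mu).$$
   Context: $\gamma$ denotes the standard centered Gaussian measure on $\mathbb{R}^d$. "Mixed moments up to order $m$ coincide" means $\int P\,d\mu=\int P\,d\gamma$ for every polynomial $P$ in $d$ variables of degree at most $m$. $\mathcal{T}_{k,d}$ is the space of $k$-tensors on $\mathbb{R}^d$ with Euclidean inner product $\langle\cdot,\cdot\rangle$ and norm $\|\cdot\|_2$; $\mathcal{T}^{sym}_{k,d}$ is the subspace of symmetric tensors. For smooth $f:\mathbb{R}^d\to\mathbb{R}^d$, $D^kf$ is the $(k+1)$-tensor of $k$-th order partial derivatives of the coordinates of $f$. A Stein kernel of order $k$ for $\mu$ is a measurable $\bar\tau_k:\mathbb{R}^d\to\mathcal{T}^{sym}_{k+1,d}$ with $\int\langle\bar\tau_k,D^kf\rangle\,d\mu=\int(x\cdot f-\mathrm{Tr}(\nabla f))\,d\mu$ for all smooth $f:\mathbb{R}^d\to\mathbb{R}^d$ such that $x\cdot f-\mathrm{Tr}(\nabla f)$ and $\|D^kf\|_2^2$ are $\mu$-integrable. The $k$-th order Stein discrepancy is $\bar S_k(\mu):=\big(\inf\int\|\bar\tau_k\|_2^2\,d\mu\big)^{1/2}$, the infimum being over all Stein kernels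 of order $k$ for $\mu$ ($+\infty$ if none exists). *)

theory Defs
  imports "HOL-Probability.Probability"
begin

definition gauss_measure :: "(real^'n::finite) measure" where
  "gauss_measure = density lborel
     (\<lambda>x. ennreal ((2 * pi) powr (- real CARD('n) / 2) * exp (- (norm x)\<^sup>2 / 2)))"

definition poly_fun_deg :: "nat \<Rightarrow> ((real^'n::finite) \<Rightarrow> real) \<Rightarrow> bool" where
  "poly_fun_deg m P \<longleftrightarrow>
     (\<exists>A c. finite A \<and> (\<forall>\<alpha>\<in>A. (\<Sum>i\<in>UNIV. \<alpha> i) \<le> m) \<and>
        (\<forall>x. P x = (\<Sum>\<alpha>\<in>A. c \<alpha> * (\<Prod>i\<in>UNIV. (x $ i) ^ (\<alpha> i)))))"

definition moments_match :: "nat \<Rightarrow> (real^'n::finite) measure \<Rightarrow> bool" where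
  "moments_match m \<mu> \<longleftrightarrow>
     (\<forall>P. poly_fun_deg m P \<longrightarrow>
        integrable \<mu> P \<and> integrable gauss_measure P \<and>
        (\<integral>x. P x \<partial>\<mu>) = (\<integral>x. P x \<partial>gauss_measure))"

definition partial :: "'n \<Rightarrow> ((real^'n::finite) \<Rightarrow> real) \<Rightarrow> (real^'n) \<Rightarrow> real" where
  "partial j g x = deriv (\<lambda>t. g (x + t *\<^sub>R axis j 1)) 0"

fun pd :: "'n list \<Rightarrow> ((real^'n::finite) \<Rightarrow> real) \<Rightarrow> (real^'n) \<Rightarrow> real" where
  "pd [] g = g"
| "pd (j # js) g = partial j (pd js g)"

definition Ck :: "nat \<Rightarrow> ((real^'n::finite) \<Rightarrow> real) \<Rightarrow> bool" where
  "Ck k g \<longleftrightarrow>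
     (\<forall>js j x. length js < k \<longrightarrow> (\<lambda>t. pd js g (x + t *\<^sub>R axis j 1)) differentiable (at 0)) \<and>
     (\<forall>js. length js \<le> k \<longrightarrow> continuous_on UNIV (pd js g))"

definition smooth_vf :: "((real^'n::finite) \<Rightarrow> real^'n) \<Rightarrow> bool" where
  "smooth_vf f \<longleftrightarrow> (\<forall>k i. Ck k (\<lambda>y. f y $ i))"

text \<open>A k-tensor on R^d is represented as a function on index lists; only lists of
  length k are relevant.\<close>
type_synonym 'n tensor = "'n list \<Rightarrow> real"

definition tinner :: "nat \<Rightarrow> 'n::finite tensor \<Rightarrow> 'n tensor \<Rightarrow> real" where
  "tinner k A B = (\<Sum>is\<in>{is::'n list. length is = k}. A is * B is)"

definition tnorm :: "nat \<Rightarrow> 'n::finite tensor \<Rightarrow> real" where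
  "tnorm k A = sqrt (tinner k A A)"

definition symmetric_tensor :: "nat \<Rightarrow> 'n::finite tensor \<Rightarrow> bool" where
  "symmetric_tensor k A \<longleftrightarrow>
     (\<forall>is js. length is = k \<longrightarrow> mset is = mset js \<longrightarrow> A is = A js)"

definition Dk_scalar :: "nat \<Rightarrow> ((real^'n::finite) \<Rightarrow> real) \<Rightarrow> (real^'n) \<Rightarrow> 'n tensor" where
  "Dk_scalar k g x = (\<lambda>js. pd js g x)"

definition Dk_vf :: "nat \<Rightarrow> ((real^'n::finite) \<Rightarrow> real^'n) \<Rightarrow> (real^'n) \<Rightarrow> 'n tensor" where
  "Dk_vf k f x = (\<lambda>is. case is of [] \<Rightarrow> 0 | i # js \<Rightarrow> pd js (\<lambda>y. f y $ i) x)"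

definition divergence :: "((real^'n::finite) \<Rightarrow> real^'n) \<Rightarrow> (real^'n) \<Rightarrow> real" where
  "divergence f x = (\<Sum>i\<in>UNIV. partial i (\<lambda>y. f y $ i) x)"

definition stein_kernel :: "nat \<Rightarrow> (real^'n::finite) measure \<Rightarrow> ((real^'n) \<Rightarrow> 'n tensor) \<Rightarrow> bool" where
  "stein_kernel k \<mu> \<tau> \<longleftrightarrow>
     (\<forall>is. (\<lambda>x. \<tau> x is) \<in> borel_measurable \<mu>) \<and>
     (\<forall>x. symmetric_tensor (k + 1) (\<tau> x)) \<and>
     (\<forall>f. smooth_vf f \<longrightarrow>
        integrable \<mu> (\<lambda>x. x \<bullet> f x - divergence f x) \<longrightarrow>
        integrable \<mu> (\<lambda>x. (tnorm (k + 1) (Dk_vf k f x))\<^sup>2) \<longrightarrow>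
        (\<integral>x. tinner (k + 1) (\<tau> x) (Dk_vf k f x) \<partial>\<mu>) = (\<integral>x. x \<bullet> f x - divergence f x \<partial>\<mu>))"

text \<open>Squared discrepancy: infimum of int ||tau||^2 d mu over Stein kernels (top if none).\<close>
definition stein_disc_sq :: "nat \<Rightarrow> (real^'n::finite) measure \<Rightarrow> ennreal" where
  "stein_disc_sq k \<mu> =
     (INF \<tau>\<in>{\<tau>. stein_kernel k \<mu> \<tau>}. \<integral>\<^sup>+ x. ennreal ((tnorm (k + 1) (\<tau> x))\<^sup>2) \<partial>\<mu>)"

definition stein_disc :: "nat \<Rightarrow> (real^'n::finite) measure \<Rightarrow> ereal" where
  "stein_disc k \<mu> =
     (if stein_disc_sq k \<mu> = \<top> then \<infinity> else ereal (sqrt (enn2real (stein_disc_sq k \<mu>))))"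

definition zol_dist :: "nat \<Rightarrow> (real^'n::finite) measure \<Rightarrow> (real^'n) measure \<Rightarrow> ereal" where
  "zol_dist k \<mu> \<nu> =
     (SUP f\<in>{f. Ck k f \<and> (\<forall>x. tnorm k (Dk_scalar k f x) \<le> 1)}.
        ereal ((\<integral>x. f x \<partial>\<mu>) - (\<integral>x. f x \<partial>\<nu>)))"

end

(*
  Let Q_u g x = E g (u x + sqrt (1 - u^2) Z) with Z standard Gaussian; this is the
  Ornstein-Uhlenbeck semigroup in the variable u = exp (-t).  For 0 <= a < 1 the vector field
  F_i = \<integral>_0^a Q_u (\<partial>_i f) du is smooth and, by the chain rule along
  u \<mapsto> u x + sqrt (1 - u^2) Z, satisfies x . F - div F = Q_a f - E f Z.
  Moving k - 1 derivatives onto f and the last one onto the Gaussian density gives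
    (D^k F)_{i j js} = \<integral>_0^a u^k / sqrt (1 - u^2) E (Z_j \<partial>_js \<partial>_i f (u x + sqrt (1 - u^2) Z)) du,
  so by Cauchy-Schwarz and \<integral>_0^1 u / sqrt (1 - u^2) du = 1 the pairing of D^k F with a tensor A is
  at most the norm of A.  Testing a Stein kernel against F and letting a tend to 1 finishes the proof.
*)
theory Submission
  imports Defs
begin

section \<open>Calculus and Lebesgue measure\<close>

text \<open>With t = - ln u, F is the gradient of the potential obtained by integrating P_t f - E f
  over t >= - ln a, and x . F - div F is minus the Ornstein-Uhlenbeck generator applied to that
  potential. F already holds one derivative of f, so D^k F would ask for k + 1 derivatives of a
  function that has k; this is why the last one must go to the Gaussian density, at the price of u /
  sqrt (1 - u^2). That factor is integrable up to u = 1 with total mass exactly 1, which is the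
  constant in the theorem, but its higher powers are not integrable there. Smoothness of F needs
  derivatives of every order, all placed on the density, and so needs the cut-off a < 1; the bound
  on D^k F spends the factor only once and is uniform in a. The moments of the measure make
  functions of growth (1 + |x|)^k integrable, f among them, and the constant polynomial gives the
  Gaussian density its total mass 1.\<close>

lemma has_real_derivative_integral:
  fixes F F' :: "real \<Rightarrow> 'a \<Rightarrow> real"
  assumes int: "\<And>t. \<bar>t\<bar> < 1 \<Longrightarrow> integrable M (F t)"
    and der: "\<And>t y. \<bar>t\<bar> < 1 \<Longrightarrow> ((\<lambda>r. F r y) has_real_derivative F' t y) (at t)"
    and bd: "\<And>t y. \<bar>t\<bar> < 1 \<Longrightarrow> \<bar>F' t y\<bar> \<le> D y"
    and D: "integrable M D"
    and meas: "F' 0 \<in> borel_measurable M"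
  shows "((\<lambda>t. \<integral>y. F t y \<partial>M) has_real_derivative (\<integral>y. F' 0 y \<partial>M)) (at 0)"
proof -
  have "((\<lambda>h. ((\<integral>y. F h y \<partial>M) - (\<integral>y. F 0 y \<partial>M)) / h) \<longlongrightarrow> (\<integral>y. F' 0 y \<partial>M)) (at 0)"
  proof (rule Lim_transform_eventually)
    \<comment> \<open>The hypotheses speak of |t| < 1 only, while dominated convergence wants a
      majorant for every term of the sequence. The difference quotient is therefore set to 0 for |h|
      >= 1, which leaves the limit unchanged.\<close>
    show "((\<lambda>h. \<integral>y. (if \<bar>h\<bar> < 1 then (F h y - F 0 y) / h else 0) \<partial>M) \<longlongrightarrow> (\<integral>y. F' 0 y \<partial>M)) (at 0)"
      unfolding tendsto_at_iff_sequentially comp_def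
    proof (intro allI impI)
      fix X :: "nat \<Rightarrow> real"
      assume X: "\<forall>i. X i \<in> UNIV - {0}" "X \<longlonglongrightarrow> 0"
      let ?G = "\<lambda>i y. if \<bar>X i\<bar> < 1 then (F (X i) y - F 0 y) / X i else 0"
      show "(\<lambda>i. \<integral>y. ?G i y \<partial>M) \<longlonglongrightarrow> (\<integral>y. F' 0 y \<partial>M)"
      proof (rule integral_dominated_convergence[where w = D])
        fix i
        show "?G i \<in> borel_measurable M"
          using int[of "X i"] int[of 0] by (cases "\<bar>X i\<bar> < 1") auto
        show "AE y in M. norm (?G i y) \<le> D y"
        proof (rule AE_I2)
          fix y
          have D0: "0 \<le> D y" using bd[of 0 y] by (smt (verit))
          show "norm (?G i y) \<le> D y"
          proof (cases "\<bar>X i\<bar> < 1")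
            case True
            have "\<bar>F (X i) y - F 0 y\<bar> \<le> D y * \<bar>X i - 0\<bar>"
              using field_differentiable_bound[of "{-1<..<1}" "\<lambda>r. F r y" "\<lambda>t. F' t y" "D y" "X i" 0]
                der bd True
              by (force simp: has_field_derivative_at_within abs_less_iff)
            then show ?thesis using True X(1) by (simp add: divide_simps abs_mult)
          qed (use D0 in simp)
        qed
      next
        show "AE y in M. (\<lambda>i. ?G i y) \<longlonglongrightarrow> F' 0 y"
        proof (rule AE_I2)
          fix y
          have "((\<lambda>h. (F h y - F 0 y) / h) \<longlongrightarrow> F' 0 y) (at 0)"
            using der[of 0 y] by (simp add: has_field_derivative_iff)
          then have 1: "(\<lambda>i. (F (X i) y - F 0 y) / X i) \<longlonglongrightarrow> F' 0 y"
            using X unfolding tendsto_at_iff_sequentially comp_def by blast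
          have "\<forall>\<^sub>F i in sequentially. \<bar>X i\<bar> < 1"
            using order_tendstoD(2)[OF tendsto_rabs[OF X(2)], of 1] by simp
          then have 2: "\<forall>\<^sub>F i in sequentially. (F (X i) y - F 0 y) / X i = ?G i y"
            by eventually_elim simp
          show "(\<lambda>i. ?G i y) \<longlonglongrightarrow> F' 0 y"
            by (rule Lim_transform_eventually[OF 1 2])
        qed
      qed (use D meas in auto)
    qed
    have "\<forall>\<^sub>F h in at 0. \<bar>h::real\<bar> < 1"
      by (auto simp: eventually_at intro!: exI[of _ 1])
    then show "\<forall>\<^sub>F h in at 0. (\<integral>y. (if \<bar>h\<bar> < 1 then (F h y - F 0 y) / h else 0) \<partial>M)
        = ((\<integral>y. F h y \<partial>M) - (\<integral>y. F 0 y \<partial>M)) / h"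
    proof eventually_elim
      fix h :: real assume "\<bar>h\<bar> < 1"
      then show "(\<integral>y. (if \<bar>h\<bar> < 1 then (F h y - F 0 y) / h else 0) \<partial>M)
        = ((\<integral>y. F h y \<partial>M) - (\<integral>y. F 0 y \<partial>M)) / h"
        using int[of h] int[of 0] by simp
    qed
  qed
  then show ?thesis by (simp add: has_field_derivative_iff)
qed

lemma
  fixes f :: "'a::euclidean_space \<Rightarrow> real"
  assumes "f \<in> borel_measurable borel"
  shows lborel_integral_translate: "(\<integral>x. f (x + c) \<partial>lborel) = (\<integral>x. f x \<partial>lborel)"
    and lborel_integrable_translate: "integrable lborel (\<lambda>x. f (x + c)) \<longleftrightarrow> integrable lborel f"
proof -
  have "(\<integral>x. f x \<partial>distr lborel borel ((+) c)) = (\<integral>x. f (c + x) \<partial>lborel)"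
    using assms by (intro integral_distr) auto
  then show "(\<integral>x. f (x + c) \<partial>lborel) = (\<integral>x. f x \<partial>lborel)"
    by (simp add: lborel_distr_plus add.commute)
  have "integrable (distr lborel borel ((+) c)) f \<longleftrightarrow> integrable lborel (\<lambda>x. f (c + x))"
    using assms by (intro integrable_distr_eq) auto
  then show "integrable lborel (\<lambda>x. f (x + c)) \<longleftrightarrow> integrable lborel f"
    by (simp add: lborel_distr_plus add.commute)
qed

text \<open>\<open>Ck\<close> controls derivatives along one axis at a time, but the chain rule
  along curves needs the total derivative. The increment from x to x + h is split into one step per
  coordinate, the mean value theorem is applied to each, and continuity of the partials replaces the
  intermediate points by x.\<close>

lemma has_derivative_continuous_partials:
  fixes g :: "real^'n::finite \<Rightarrow> real" and g' :: "'n \<Rightarrow> real^'n \<Rightarrow> real"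
  assumes der: "\<And>j x. ((\<lambda>t. g (x + t *\<^sub>R axis j 1)) has_real_derivative g' j x) (at 0)"
    and cont: "\<And>j. continuous_on UNIV (g' j)"
  shows "(g has_derivative (\<lambda>h. \<Sum>j\<in>UNIV. h $ j * g' j x)) (at x)"
proof -
  have der': "((\<lambda>t. g (y + t *\<^sub>R axis j 1)) has_real_derivative g' j (y + r *\<^sub>R axis j 1)) (at r)" for j y r
  proof -
    have "((\<lambda>t. g ((y + r *\<^sub>R axis j 1) + t *\<^sub>R axis j 1)) has_real_derivative g' j (y + r *\<^sub>R axis j 1)) (at 0)"
      by (rule der)
    then have "((\<lambda>t. g (y + (t + r) *\<^sub>R axis j 1)) has_real_derivative g' j (y + r *\<^sub>R axis j 1)) (at 0)"
      by (simp add: algebra_simps)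
    then show ?thesis using DERIV_shift[of "\<lambda>t. g (y + t *\<^sub>R axis j 1)" _ 0 r] by simp
  qed
  \<comment> \<open>\<open>v S h\<close> keeps the coordinates of h in S and zeroes the others;
    adding indices to S one by one gives the staircase from x to x + h.\<close>
  define v where "v S h = (\<Sum>j\<in>S. (h $ j) *\<^sub>R axis j (1::real))" for S and h :: "real^'n"
  have vcomp: "v S h $ i = (if i \<in> S then h $ i else 0)" for S h i
    by (simp add: v_def axis_def if_distrib[of "\<lambda>x. _ * x"] cong: if_cong)
  \<comment> \<open>Intermediate points of the staircase are within norm h of x, so one radius
    serves all the steps.\<close>
  have vnorm: "norm (v S h + (\<theta> * h $ j) *\<^sub>R axis j 1) \<le> norm h"
    if "j \<notin> S" "\<bar>\<theta>\<bar> \<le> 1" for S h j and \<theta> :: real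
    by (rule norm_le_componentwise_cart)
      (use that in \<open>auto simp: vcomp axis_def abs_mult mult_left_le_one_le\<close>)
  have vU: "v UNIV h = h" for h by (simp add: vec_eq_iff vcomp)
  have "\<exists>d>0. \<forall>h. norm h < d \<longrightarrow>
      \<bar>g (x + h) - g x - (\<Sum>j\<in>UNIV. h $ j * g' j x)\<bar> \<le> e * norm h" if e: "e > 0" for e
  proof -
    define e1 where "e1 = e / CARD('n)"
    have e1: "e1 > 0" using e by (simp add: e1_def)
    have "\<forall>j. \<exists>d>0. \<forall>y. norm (y - x) < d \<longrightarrow> \<bar>g' j y - g' j x\<bar> < e1"
      using cont e1 by (auto simp: continuous_on_iff dist_norm)
    then obtain d where d: "\<And>j. d j > 0" "\<And>j y. norm (y - x) < d j \<Longrightarrow> \<bar>g' j y - g' j x\<bar> < e1"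
      by metis
    have "\<bar>g (x + v S h) - g x - (\<Sum>j\<in>S. h $ j * g' j x)\<bar> \<le> card S * (e1 * norm h)"
      if h: "norm h < Min (range d)" for h S
    proof -
      have "finite S" by simp
      then show ?thesis
      proof induction
        case (insert i S)
        have "\<exists>\<theta>. 0 \<le> \<theta> \<and> \<theta> \<le> 1 \<and> g (x + v S h + (h$i) *\<^sub>R axis i 1) - g (x + v S h)
          = h $ i * g' i (x + v S h + (\<theta> * h $ i) *\<^sub>R axis i 1)"
        proof -
          have "((\<lambda>t. g (x + v S h + (t * h$i) *\<^sub>R axis i 1)) has_real_derivative
              g' i (x + v S h + (r * h $ i) *\<^sub>R axis i 1) * h$i) (at r)" for r
            by (rule DERIV_chain2[OF der']) (auto intro!: derivative_eq_intros)
          from MVT2[of 0 1, OF _ this]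
          obtain z where "0 < z" "z < 1" "g (x + v S h + (1 * h$i) *\<^sub>R axis i 1) - g (x + v S h + (0 * h$i) *\<^sub>R axis i 1)
             = (1 - 0) * (g' i (x + v S h + (z * h $ i) *\<^sub>R axis i 1) * h$i)" by auto
          then show ?thesis by (intro exI[of _ z]) auto
        qed
        then obtain \<theta> where th: "0 \<le> \<theta>" "\<theta> \<le> 1"
          "g (x + v S h + (h$i) *\<^sub>R axis i 1) - g (x + v S h)
            = h $ i * g' i (x + v S h + (\<theta> * h $ i) *\<^sub>R axis i 1)" by blast
        let ?y = "x + v S h + (\<theta> * h $ i) *\<^sub>R axis i 1"
        have "norm (?y - x) \<le> norm h" using vnorm[of i S \<theta> h] insert th by (simp add: algebra_simps)
        also have "\<dots> < d i" using h by simp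
        finally have "\<bar>g' i ?y - g' i x\<bar> < e1" by (rule d)
        then have "\<bar>h $ i\<bar> * \<bar>g' i ?y - g' i x\<bar> \<le> norm h * e1"
          using component_le_norm_cart[of h i] by (intro mult_mono) auto
        then have 1: "\<bar>h $ i * g' i ?y - h $ i * g' i x\<bar> \<le> norm h * e1"
          by (simp flip: abs_mult add: right_diff_distrib)
        have "x + v (insert i S) h = x + v S h + (h$i) *\<^sub>R axis i 1"
          using insert by (simp add: v_def)
        with th 1 insert show ?case by (simp add: algebra_simps)
      qed (simp add: v_def)
    qed
    from this[where S=UNIV] have "\<forall>h. norm h < Min (range d) \<longrightarrow>
      \<bar>g (x + h) - g x - (\<Sum>j\<in>UNIV. h $ j * g' j x)\<bar> \<le> e * norm h"
      by (simp add: vU e1_def)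
    moreover have "Min (range d) > 0" using d(1) by simp
    ultimately show ?thesis by blast
  qed
  moreover have "bounded_linear (\<lambda>h. \<Sum>j\<in>UNIV. h $ j * g' j x)"
    by (intro bounded_linear_sum bounded_linear_mult_const bounded_linear_vec_nth)
  ultimately show ?thesis
    unfolding has_derivative_at_alt
  proof (intro conjI allI impI)
    fix e :: real assume "e > 0"
    then obtain d where d: "d > 0" "\<And>h. norm h < d \<Longrightarrow>
      \<bar>g (x + h) - g x - (\<Sum>j\<in>UNIV. h $ j * g' j x)\<bar> \<le> e * norm h"
      using \<open>\<And>e. e > 0 \<Longrightarrow> _\<close> by blast
    show "\<exists>d>0. \<forall>y. norm (y - x) < d \<longrightarrow>
         norm (g y - g x - (\<Sum>j\<in>UNIV. (y - x) $ j * g' j x)) \<le> e * norm (y - x)"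
      using d(1) d(2)[of "y - x" for y] by (intro exI[of _ d]) auto
  qed auto
qed

text \<open>The rate d = \<open>CARD('n)\<close> comes from |z_1| + ... + |z_d| <= d |z|: the
  exponential is at most a product of functions of single coordinates, each of which is at most 2 /
  (1 + y^2).\<close>

lemma integrable_exp_norm:
  "integrable lborel (\<lambda>z::real^'n::finite. exp (- real CARD('n) * norm z))"
proof (rule integrableI_bounded)
  let ?h = "\<lambda>y::real. 2 * inverse (1 + y\<^sup>2)"
  have h: "exp (- \<bar>y\<bar>) \<le> ?h y" for y :: real
  proof -
    have "1 + y\<^sup>2 / 2 \<le> exp \<bar>y\<bar>" using exp_lower_Taylor_quadratic[of "\<bar>y\<bar>"] by simp
    then have "1 + y\<^sup>2 \<le> 2 * exp \<bar>y\<bar>" by simp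
    then show ?thesis by (simp add: exp_minus divide_simps add_pos_nonneg)
  qed
  have "integrable lborel (\<lambda>y::real. inverse (1 + y\<^sup>2))"
    using integrable_inverse_1_plus_square by (simp add: set_integrable_def)
  then have "integrable lborel ?h" by simp
  then have fin: "(\<integral>\<^sup>+y. ennreal (?h y) \<partial>lborel) < \<infinity>"
    by (subst (asm) integrable_iff_bounded) (simp add: abs_of_nonneg)
  have "(\<integral>\<^sup>+ z. ennreal (norm (exp (- real CARD('n) * norm (z::real^'n)))) \<partial>lborel)
      \<le> (\<integral>\<^sup>+ z. (\<Prod>b\<in>Basis. ennreal (?h ((z::real^'n) \<bullet> b))) \<partial>lborel)"
  proof (rule nn_integral_mono)
    fix z :: "real^'n"
    have "(\<Sum>b\<in>Basis. \<bar>z \<bullet> b\<bar>) \<le> (\<Sum>b\<in>(Basis::(real^'n) set). norm z)"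
      by (intro sum_mono) (simp add: Basis_le_norm)
    then have "exp (- real CARD('n) * norm z) \<le> exp (\<Sum>b\<in>Basis. - \<bar>z \<bullet> b\<bar>)"
      by (simp add: sum_negf)
    also have "\<dots> = (\<Prod>b\<in>Basis. exp (- \<bar>z \<bullet> b\<bar>))" by (simp add: exp_sum)
    also have "\<dots> \<le> (\<Prod>b\<in>Basis. ?h (z \<bullet> b))" using h by (intro prod_mono) auto
    finally show "ennreal (norm (exp (- real CARD('n) * norm z))) \<le> (\<Prod>b\<in>Basis. ennreal (?h (z \<bullet> b)))"
      by (subst prod_ennreal) (auto simp: ennreal_leI)
  qed
  also have "\<dots> = (\<Prod>b\<in>(Basis::(real^'n) set). (\<integral>\<^sup>+y. ennreal (?h y) \<partial>lborel))"
    by (rule nn_integral_lborel_prod) auto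
  also have "\<dots> < \<infinity>" using fin by (simp add: power_less_top_ennreal)
  finally show "(\<integral>\<^sup>+ z. ennreal (norm (exp (- real CARD('n) * norm (z::real^'n)))) \<partial>lborel) < \<infinity>" .
qed simp

section \<open>Gaussian averages and their partial derivatives\<close>

text \<open>\<open>partial\<close> is a \<open>deriv\<close> and carries no information where no
  derivative exists; this relation records existence together with the value. A derivative at 0 is
  enough because the base point ranges over the whole space.\<close>

definition has_partial :: "'n \<Rightarrow> (real^'n::finite \<Rightarrow> real) \<Rightarrow> (real^'n \<Rightarrow> real) \<Rightarrow> bool" where
  "has_partial j g g' \<longleftrightarrow>
     (\<forall>x. ((\<lambda>t. g (x + t *\<^sub>R axis j 1)) has_real_derivative g' x) (at 0))"

lemma has_partialD:
  assumes "has_partial j g g'"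
  shows "((\<lambda>t. g (x + t *\<^sub>R axis j 1)) has_real_derivative g' (x + r *\<^sub>R axis j 1)) (at r)"
proof -
  have "((\<lambda>t. g ((x + r *\<^sub>R axis j 1) + t *\<^sub>R axis j 1)) has_real_derivative g' (x + r *\<^sub>R axis j 1)) (at 0)"
    using assms by (simp add: has_partial_def)
  then have "((\<lambda>t. g (x + (t + r) *\<^sub>R axis j 1)) has_real_derivative g' (x + r *\<^sub>R axis j 1)) (at 0)"
    by (simp add: algebra_simps)
  then show ?thesis using DERIV_shift[of "\<lambda>t. g (x + t *\<^sub>R axis j 1)" _ 0 r] by simp
qed

lemma partial_eq: "has_partial j g g' \<Longrightarrow> partial j g = g'"
  unfolding has_partial_def partial_def by (intro ext DERIV_imp_deriv) blast

definition gauss_dens :: "real^'n::finite \<Rightarrow> real" where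
  "gauss_dens z = (2 * pi) powr (- real CARD('n) / 2) * exp (- (norm z)\<^sup>2 / 2)"

text \<open>Polynomials times the Gaussian density, generated so that closure under partial
  derivatives and decay bounds become inductions. Whatever integration by parts puts in place of the
  density stays in this class.\<close>

inductive gauss_poly :: "(real^'n::finite \<Rightarrow> real) \<Rightarrow> bool" where
  dens: "gauss_poly gauss_dens"
| coord: "gauss_poly \<psi> \<Longrightarrow> gauss_poly (\<lambda>z. z $ i * \<psi> z)"
| lincomb: "gauss_poly \<psi> \<Longrightarrow> gauss_poly \<eta> \<Longrightarrow> gauss_poly (\<lambda>z. a * \<psi> z + b * \<eta> z)"

lemma gauss_poly_continuous: "gauss_poly \<psi> \<Longrightarrow> continuous_on UNIV \<psi>"
  by (induction rule: gauss_poly.induct) (auto intro!: continuous_intros simp: gauss_dens_def[abs_def])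

text \<open>The rate N has to be arbitrary: each factor \<open>z $ i\<close> uses up one unit of it,
  since |z_i| <= exp |z|. The density itself has every rate, because (|z| - N)^2 >= 0.\<close>

lemma gauss_poly_bound:
  assumes "gauss_poly \<psi>"
  shows "\<exists>C\<ge>0. \<forall>z. \<bar>\<psi> z\<bar> \<le> C * exp (- N * norm z)"
  using assms
proof (induction arbitrary: N rule: gauss_poly.induct)
  case dens
  let ?c = "(2 * pi) powr (- real CARD('a) / 2)"
  have "\<bar>gauss_dens z\<bar> \<le> (?c * exp (N\<^sup>2 / 2)) * exp (- N * norm z)" for z :: "real^'a"
  proof -
    have "0 \<le> (norm z - N)\<^sup>2" by simp
    then have "- (norm z)\<^sup>2 / 2 \<le> N\<^sup>2 / 2 + (- N * norm z)" by (simp add: power2_eq_square algebra_simps)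
    then have "exp (- (norm z)\<^sup>2 / 2) \<le> exp (N\<^sup>2 / 2) * exp (- N * norm z)"
      by (simp flip: exp_add)
    then show ?thesis by (simp add: gauss_dens_def abs_mult mult.assoc mult_left_mono)
  qed
  then show ?case by (intro exI[of _ "?c * exp (N\<^sup>2 / 2)"]) simp
next
  case (coord \<psi> i)
  obtain C where C: "C \<ge> 0" "\<And>z. \<bar>\<psi> z\<bar> \<le> C * exp (- (N + 1) * norm z)" using coord.IH by blast
  have "\<bar>z $ i * \<psi> z\<bar> \<le> C * exp (- N * norm z)" for z
  proof -
    have "\<bar>z $ i\<bar> \<le> exp (norm z)"
      using component_le_norm_cart[of z i] exp_ge_add_one_self[of "norm z"] by linarith
    then have "\<bar>z $ i * \<psi> z\<bar> \<le> exp (norm z) * (C * exp (- (N + 1) * norm z))"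
      unfolding abs_mult using C(2)[of z] by (intro mult_mono) auto
    also have "\<dots> = C * exp (- N * norm z)" by (simp add: algebra_simps flip: exp_add)
    finally show ?thesis .
  qed
  with C(1) show ?case by blast
next
  case (lincomb \<psi> \<eta> a b)
  obtain C where C: "C \<ge> 0" "\<And>z. \<bar>\<psi> z\<bar> \<le> C * exp (- N * norm z)" using lincomb.IH(1) by blast
  obtain D where D: "D \<ge> 0" "\<And>z. \<bar>\<eta> z\<bar> \<le> D * exp (- N * norm z)" using lincomb.IH(2) by blast
  have "\<bar>a * \<psi> z + b * \<eta> z\<bar> \<le> (\<bar>a\<bar> * C + \<bar>b\<bar> * D) * exp (- N * norm z)" for z
  proof -
    have "\<bar>a * \<psi> z + b * \<eta> z\<bar> \<le> \<bar>a\<bar> * \<bar>\<psi> z\<bar> + \<bar>b\<bar> * \<bar>\<eta> z\<bar>"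
      by (metis abs_mult abs_triangle_ineq)
    also have "\<dots> \<le> \<bar>a\<bar> * (C * exp (- N * norm z)) + \<bar>b\<bar> * (D * exp (- N * norm z))"
      using C(2)[of z] D(2)[of z] by (intro add_mono mult_left_mono) auto
    finally show ?thesis by (simp add: algebra_simps)
  qed
  with C(1) D(1) show ?case by (intro exI[of _ "\<bar>a\<bar> * C + \<bar>b\<bar> * D"]) simp
qed

lemma gauss_poly_uminus: "gauss_poly \<psi> \<Longrightarrow> gauss_poly (\<lambda>z. - \<psi> z)"
  using gauss_poly.lincomb[of \<psi> \<psi> "-1" 0] by simp

lemma has_partial_gauss_dens: "has_partial (j::'n::finite) gauss_dens (\<lambda>z. - (z $ j * gauss_dens z))"
proof -
  have n: "(norm (x + t *\<^sub>R axis j 1))\<^sup>2 = x \<bullet> x + 2 * t * x $ j + t\<^sup>2"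
    for x :: "real^'n" and j :: 'n and t
    unfolding power2_norm_eq_inner
    by (simp add: inner_add inner_axis inner_axis' power2_eq_square algebra_simps)
  show ?thesis
    unfolding has_partial_def gauss_dens_def n
    by (auto intro!: derivative_eq_intros simp: power2_norm_eq_inner)
qed

lemma has_partial_coord:
  assumes "has_partial j \<psi> \<eta>"
  shows "has_partial j (\<lambda>z. z $ i * \<psi> z) (\<lambda>z. (if i = j then 1 else 0) * \<psi> z + z $ i * \<eta> z)"
  using assms unfolding has_partial_def
  by (auto intro!: derivative_eq_intros simp: axis_def)

lemma has_partial_lincomb:
  assumes "has_partial j \<psi> \<psi>'" "has_partial j \<eta> \<eta>'"
  shows "has_partial j (\<lambda>z. a * \<psi> z + b * \<eta> z) (\<lambda>z. a * \<psi>' z + b * \<eta>' z)"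
  using assms unfolding has_partial_def
  by (auto intro!: derivative_eq_intros)

lemma gauss_poly_partial: "gauss_poly \<psi> \<Longrightarrow> \<exists>\<eta>. gauss_poly \<eta> \<and> has_partial j \<psi> \<eta>"
proof (induction rule: gauss_poly.induct)
  case dens
  show ?case using has_partial_gauss_dens gauss_poly.intros gauss_poly_uminus by blast
next
  case (coord \<psi> i)
  then obtain \<eta> where "gauss_poly \<eta>" "has_partial j \<psi> \<eta>" by blast
  then show ?case
    using has_partial_coord[of j \<psi> \<eta> i] gauss_poly.lincomb[OF coord.hyps gauss_poly.coord, of \<eta> _ 1 i]
    by auto
next
  case (lincomb \<psi> \<eta> a b)
  then show ?case using has_partial_lincomb gauss_poly.lincomb by blast
qed

section \<open>Weighted averages over u and z: domination, continuity, differentiation\<close>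

definition exp_growth :: "(real^'n::finite \<Rightarrow> real) \<Rightarrow> bool" where
  "exp_growth g \<longleftrightarrow> continuous_on UNIV g \<and> (\<exists>C. \<forall>y. \<bar>g y\<bar> \<le> C * exp (norm y))"

text \<open>The single inequality encodes both boundedness and support in [0, a]. For a < 1 the
  class is stable under multiplication by u and by u / sqrt (1 - u^2), the two factors that
  differentiation produces.\<close>

definition weight :: "real \<Rightarrow> (real \<Rightarrow> real) \<Rightarrow> bool" where
  "weight a w \<longleftrightarrow> w \<in> borel_measurable borel \<and> (\<exists>C. \<forall>u. \<bar>w u\<bar> \<le> C * indicator {0..a} u)"

text \<open>For x in a bounded set, the integrands of the averages below are at most a constant
  times this function, so its integrability serves every passage to the limit in them.\<close>

definition dominator :: "real \<Rightarrow> real \<times> (real^'n::finite) \<Rightarrow> real" where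
  "dominator a = (\<lambda>(u, z). indicator {0..a} u * exp (- real CARD('n) * norm z))"

lemma dominator_nonneg [simp]: "0 \<le> dominator a p"
  by (simp add: dominator_def split_beta)

lemma integrable_dominator:
  "integrable (lborel \<Otimes>\<^sub>M lborel) (dominator a :: real \<times> (real^'n::finite) \<Rightarrow> real)"
proof (rule lborel_pair.Fubini_integrable)
  show "(dominator a :: real \<times> (real^'n) \<Rightarrow> real) \<in> borel_measurable (lborel \<Otimes>\<^sub>M lborel)"
    unfolding dominator_def by measurable
  show "integrable lborel (\<lambda>u. \<integral>z. norm (dominator a (u, z :: real^'n)) \<partial>lborel)"
    by (auto simp: dominator_def abs_mult integrable_real_indicator emeasure_lborel_Icc_eq)
  show "AE u in lborel. integrable lborel (\<lambda>z::real^'n. dominator a (u, z))"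
    using integrable_exp_norm[where 'n = 'n] by (simp add: dominator_def)
qed

text \<open>With w the indicator of [0, a] and \<psi> = \<open>gauss_dens\<close> this is the
  integral of Q_u g over u from 0 to a. Leaving w and \<psi> free gives a family closed under
  differentiation in x; the single integral over pairs makes each derivative one application of
  dominated convergence.\<close>

definition ou_avg :: "(real \<Rightarrow> real) \<Rightarrow> (real^'n::finite \<Rightarrow> real) \<Rightarrow> (real^'n \<Rightarrow> real) \<Rightarrow> real^'n \<Rightarrow> real" where
  "ou_avg w \<psi> g x = (\<integral>(u, z). w u * \<psi> z * g (u *\<^sub>R x + sqrt (1 - u\<^sup>2) *\<^sub>R z) \<partial>(lborel \<Otimes>\<^sub>M lborel))"

lemma weight_mult:
  assumes "weight a w" "v \<in> borel_measurable borel" "\<And>u. 0 \<le> u \<Longrightarrow> u \<le> a \<Longrightarrow> \<bar>v u\<bar> \<le> B"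
  shows "weight a (\<lambda>u. w u * v u)"
proof -
  obtain C where C: "\<And>u. \<bar>w u\<bar> \<le> C * indicator {0..a} u" using assms(1) by (auto simp: weight_def)
  have "\<bar>w u * v u\<bar> \<le> (C * B) * indicator {0..a} u" for u
    using C[of u] assms(3)[of u] by (auto simp: abs_mult indicator_def split: if_splits intro!: mult_mono)
  then show ?thesis using assms unfolding weight_def by auto
qed

lemma weight_zero: "weight a w \<Longrightarrow> u \<notin> {0..a} \<Longrightarrow> w u = 0"
  unfolding weight_def by (metis abs_le_zero_iff indicator_simps(2) mult_zero_right)

lemma sqrt_one_minus_bounds:
  assumes "u \<in> {0..a}" "a < (1::real)"
  shows "sqrt (1 - u\<^sup>2) > 0" "sqrt (1 - u\<^sup>2) \<le> 1" "\<bar>u / sqrt (1 - u\<^sup>2)\<bar> \<le> 1 / sqrt (1 - a\<^sup>2)"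
proof -
  have "u\<^sup>2 \<le> a\<^sup>2" "a\<^sup>2 < 1" using assms by (auto intro!: power_mono simp: abs_square_less_1)
  then have 1: "u\<^sup>2 \<le> 1" "u\<^sup>2 \<le> a\<^sup>2" "a\<^sup>2 < 1" by linarith+
  then show "sqrt (1 - u\<^sup>2) > 0" "sqrt (1 - u\<^sup>2) \<le> 1" by simp_all
  have 2: "sqrt (1 - a\<^sup>2) \<le> sqrt (1 - u\<^sup>2)" "0 < sqrt (1 - a\<^sup>2)" using 1 by simp_all
  have "0 \<le> u / sqrt (1 - u\<^sup>2)"
    using assms(1) 1(1) by (metis atLeastAtMost_iff diff_ge_0_iff_ge divide_nonneg_nonneg real_sqrt_ge_zero)
  then have "\<bar>u / sqrt (1 - u\<^sup>2)\<bar> = u / sqrt (1 - u\<^sup>2)" by (rule abs_of_nonneg)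
  also have "\<dots> \<le> 1 / sqrt (1 - a\<^sup>2)" using assms 2 by (intro frac_le) simp_all
  finally show "\<bar>u / sqrt (1 - u\<^sup>2)\<bar> \<le> 1 / sqrt (1 - a\<^sup>2)" .
qed

lemma weight_mult_id: "weight a w \<Longrightarrow> weight a (\<lambda>u. w u * u)"
  by (rule weight_mult[where B = "\<bar>a\<bar>"]) auto

lemma weight_mult_quotient:
  assumes "weight a w" "a < 1"
  shows "weight a (\<lambda>u. w u * (u / sqrt (1 - u\<^sup>2)))"
  by (rule weight_mult[OF assms(1), where B = "1 / sqrt (1 - a\<^sup>2)"])
    (measurable, use sqrt_one_minus_bounds assms(2) in auto)

text \<open>The shift v is there for the integrands that arise when a shift of x is moved to \<psi>;
  a bounded shift costs only the constant factor exp (N B).\<close>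

lemma ou_integrand_bound:
  fixes \<psi> g :: "real^'n::finite \<Rightarrow> real"
  assumes "a < 1" "weight a w" "gauss_poly \<psi>" "exp_growth g" and B: "0 \<le> B"
  obtains K where "0 \<le> K" "\<And>x u z v. norm v \<le> B \<Longrightarrow>
    \<bar>w u * \<psi> (z - v) * g (u *\<^sub>R x + sqrt (1 - u\<^sup>2) *\<^sub>R z)\<bar> \<le> K * exp (norm x) * dominator a (u, z)"
proof -
  \<comment> \<open>One unit of the decay rate pays for the growth of g, since u x + sqrt (1 - u^2)
    z has norm at most |x| + |z|; the other \<open>CARD('n)\<close> units make the bound integrable
    in z.\<close>
  define N where "N = real CARD('n) + 1"
  have N: "0 \<le> N" by (simp add: N_def)
  obtain C1 where C1: "\<And>u. \<bar>w u\<bar> \<le> C1 * indicator {0..a} u" using assms(2) by (auto simp: weight_def)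
  obtain C2 where C2: "C2 \<ge> 0" "\<And>z. \<bar>\<psi> z\<bar> \<le> C2 * exp (- N * norm z)" using gauss_poly_bound[OF assms(3)] by blast
  obtain C3 where C3: "\<And>y. \<bar>g y\<bar> \<le> C3 * exp (norm y)" using assms(4) by (auto simp: exp_growth_def)
  have C3pos: "0 \<le> C3" using C3[of 0] by simp
  define K where "K = \<bar>C1\<bar> * (C2 * exp (N * B)) * C3"
  have "\<bar>w u * \<psi> (z - v) * g (u *\<^sub>R x + sqrt (1 - u\<^sup>2) *\<^sub>R z)\<bar> \<le> K * exp (norm x) * dominator a (u, z)"
    if v: "norm v \<le> B" for x u z v
  proof (cases "u \<in> {0..a}")
    case True
    note s = sqrt_one_minus_bounds[OF True assms(1)]
    have w: "\<bar>w u\<bar> \<le> \<bar>C1\<bar>" using C1[of u] True by simp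
    have "norm z - B \<le> norm (z - v)" using norm_triangle_ineq2[of z v] v by linarith
    then have "N * (norm z - B) \<le> N * norm (z - v)" using N by (rule mult_left_mono)
    then have "exp (- N * norm (z - v)) \<le> exp (N * B) * exp (- N * norm z)"
      by (simp add: algebra_simps flip: exp_add)
    then have p: "\<bar>\<psi> (z - v)\<bar> \<le> C2 * exp (N * B) * exp (- N * norm z)"
      using C2(2)[of "z - v"] mult_left_mono[OF _ C2(1)] by (fastforce simp: mult.assoc)
    have "norm (u *\<^sub>R x + sqrt (1 - u\<^sup>2) *\<^sub>R z) \<le> u * norm x + sqrt (1 - u\<^sup>2) * norm z"
      using True s(1) by (intro norm_triangle_le) simp
    also have "\<dots> \<le> norm x + norm z"
      using True assms(1) s by (intro add_mono mult_left_le_one_le) auto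
    finally have "exp (norm (u *\<^sub>R x + sqrt (1 - u\<^sup>2) *\<^sub>R z)) \<le> exp (norm x) * exp (norm z)"
      by (simp flip: exp_add)
    then have g: "\<bar>g (u *\<^sub>R x + sqrt (1 - u\<^sup>2) *\<^sub>R z)\<bar> \<le> C3 * (exp (norm x) * exp (norm z))"
      using C3 C3pos by (meson mult_left_mono order_trans)
    have "\<bar>w u * \<psi> (z - v) * g (u *\<^sub>R x + sqrt (1 - u\<^sup>2) *\<^sub>R z)\<bar>
      \<le> \<bar>C1\<bar> * (C2 * exp (N * B) * exp (- N * norm z)) * (C3 * (exp (norm x) * exp (norm z)))"
      unfolding abs_mult using w p g C2(1) by (intro mult_mono) auto
    also have "\<dots> = K * exp (norm x) * (exp (- N * norm z) * exp (norm z))"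
      by (simp add: K_def)
    also have "\<dots> = K * exp (norm x) * dominator a (u, z)"
      using True by (simp add: dominator_def N_def algebra_simps flip: exp_add)
    finally show ?thesis .
  qed (use weight_zero[OF assms(2)] in \<open>simp add: dominator_def\<close>)
  moreover have "0 \<le> K" using C2(1) C3pos by (simp add: K_def)
  ultimately show thesis using that by blast
qed

lemma ou_integrand_integrable:
  fixes \<psi> g :: "real^'n::finite \<Rightarrow> real"
  assumes "a < 1" "weight a w" "gauss_poly \<psi>" "exp_growth g"
    and "c \<in> borel_measurable borel" "\<And>u. u \<in> {0..a} \<Longrightarrow> norm (c u) \<le> B"
  shows "integrable (lborel \<Otimes>\<^sub>M lborel)
     (\<lambda>(u, z). w u * \<psi> (z - c u) * g (u *\<^sub>R x + sqrt (1 - u\<^sup>2) *\<^sub>R z))"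
proof -
  obtain K where K: "0 \<le> K" "\<And>x u z v. norm v \<le> \<bar>B\<bar> \<Longrightarrow>
    \<bar>w u * \<psi> (z - v) * g (u *\<^sub>R x + sqrt (1 - u\<^sup>2) *\<^sub>R z)\<bar> \<le> K * exp (norm x) * dominator a (u, z)"
    using ou_integrand_bound[OF assms(1-4), of "\<bar>B\<bar>"] by auto
  have [measurable]: "w \<in> borel_measurable borel" "\<psi> \<in> borel_measurable borel"
    "g \<in> borel_measurable borel" "c \<in> borel_measurable borel"
    using assms(2,4,5) gauss_poly_continuous[OF assms(3)]
    by (auto simp: weight_def exp_growth_def intro: borel_measurable_continuous_onI)
  show ?thesis
  proof (rule Bochner_Integration.integrable_bound)
    show "integrable (lborel \<Otimes>\<^sub>M lborel) (\<lambda>p :: real \<times> (real^'n). K * exp (norm x) * dominator a p)"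
      by (simp add: integrable_dominator)
    show "(\<lambda>(u, z). w u * \<psi> (z - c u) * g (u *\<^sub>R x + sqrt (1 - u\<^sup>2) *\<^sub>R z)) \<in> borel_measurable (lborel \<Otimes>\<^sub>M lborel)"
      by measurable
    show "AE p in lborel \<Otimes>\<^sub>M lborel. norm (case p of (u, z) \<Rightarrow> w u * \<psi> (z - c u) * g (u *\<^sub>R x + sqrt (1 - u\<^sup>2) *\<^sub>R z))
      \<le> norm (K * exp (norm x) * dominator a p)"
    proof (rule AE_I2, clarify)
      fix u z
      show "norm (w u * \<psi> (z - c u) * g (u *\<^sub>R x + sqrt (1 - u\<^sup>2) *\<^sub>R z))
        \<le> norm (K * exp (norm x) * dominator a (u, z))"
      proof (cases "u \<in> {0..a}")
        case True
        then have "norm (c u) \<le> \<bar>B\<bar>" using assms(6)[of u] by linarith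
        from K(2)[OF this, of u z x] K(1) show ?thesis by (simp add: abs_mult)
      qed (use weight_zero[OF assms(2)] in simp)
    qed
  qed
qed

text \<open>For fixed u the shear is a translation in z, under which Lebesgue measure is invariant;
  Fubini on both sides reduces the identity to that.\<close>

lemma lborel_pair_integral_shear:
  fixes f :: "real \<times> (real^'n::finite) \<Rightarrow> real"
  assumes "integrable (lborel \<Otimes>\<^sub>M lborel) f"
    and "integrable (lborel \<Otimes>\<^sub>M lborel) (\<lambda>(u, z). f (u, z + c u))"
  shows "(\<integral>(u, z). f (u, z + c u) \<partial>(lborel \<Otimes>\<^sub>M lborel)) = integral\<^sup>L (lborel \<Otimes>\<^sub>M lborel) f"
proof -
  have [measurable]: "f \<in> borel_measurable (lborel \<Otimes>\<^sub>M lborel)" using assms(1) by auto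
  have "(\<integral>(u, z). f (u, z + c u) \<partial>(lborel \<Otimes>\<^sub>M lborel)) = (\<integral>u. (\<integral>z. f (u, z + c u) \<partial>lborel) \<partial>lborel)"
    using lborel_pair.integral_fst'[OF assms(2)] by simp
  also have "\<dots> = (\<integral>u. (\<integral>z. f (u, z) \<partial>lborel) \<partial>lborel)"
    by (intro Bochner_Integration.integral_cong refl lborel_integral_translate) measurable
  also have "\<dots> = integral\<^sup>L (lborel \<Otimes>\<^sub>M lborel) f" by (rule lborel_pair.integral_fst'[OF assms(1)])
  finally show ?thesis .
qed

lemma ou_avg_continuous:
  fixes \<psi> g :: "real^'n::finite \<Rightarrow> real"
  assumes "a < 1" "weight a w" "gauss_poly \<psi>" "exp_growth g"
  shows "continuous_on UNIV (ou_avg w \<psi> g)"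
  unfolding continuous_on_sequentially comp_def
proof (intro allI ballI impI, elim conjE)
  fix X and x :: "real^'n"
  assume X: "X \<longlonglongrightarrow> x"
  \<comment> \<open>A convergent sequence is bounded, so exp |X n| <= exp R turns the majorant that
    depends on the point into one that serves all n.\<close>
  obtain R where R: "\<And>n. norm (X n) \<le> R"
    using convergent_imp_Bseq[OF convergentI[OF X]] by (auto simp: Bseq_def)
  obtain K where K: "0 \<le> K" "\<And>x u z v. norm v \<le> 0 \<Longrightarrow>
    \<bar>w u * \<psi> (z - v) * g (u *\<^sub>R x + sqrt (1 - u\<^sup>2) *\<^sub>R z)\<bar> \<le> K * exp (norm x) * dominator a (u, z)"
    using ou_integrand_bound[OF assms, of 0] by auto
  have g: "continuous_on UNIV g" using assms(4) by (simp add: exp_growth_def)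
  have int: "integrable (lborel \<Otimes>\<^sub>M lborel) (\<lambda>(u, z). w u * \<psi> z * g (u *\<^sub>R y + sqrt (1 - u\<^sup>2) *\<^sub>R z))" for y
    using ou_integrand_integrable[OF assms, of "\<lambda>_. 0" 0 y] by simp
  show "(\<lambda>n. ou_avg w \<psi> g (X n)) \<longlonglongrightarrow> ou_avg w \<psi> g x"
    unfolding ou_avg_def
  proof (rule integral_dominated_convergence[where w = "\<lambda>p. K * exp R * dominator a p"])
    show "AE p in lborel \<Otimes>\<^sub>M lborel. (\<lambda>n. case p of (u, z) \<Rightarrow> w u * \<psi> z * g (u *\<^sub>R X n + sqrt (1 - u\<^sup>2) *\<^sub>R z))
      \<longlonglongrightarrow> (case p of (u, z) \<Rightarrow> w u * \<psi> z * g (u *\<^sub>R x + sqrt (1 - u\<^sup>2) *\<^sub>R z))"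
      by (auto intro!: tendsto_intros X continuous_on_tendsto_compose[OF g])
    show "AE p in lborel \<Otimes>\<^sub>M lborel. norm (case p of (u, z) \<Rightarrow> w u * \<psi> z * g (u *\<^sub>R X n + sqrt (1 - u\<^sup>2) *\<^sub>R z))
      \<le> K * exp R * dominator a p" for n
    proof (rule AE_I2, clarify)
      fix u z
      have "norm (w u * \<psi> z * g (u *\<^sub>R X n + sqrt (1 - u\<^sup>2) *\<^sub>R z)) \<le> K * exp (norm (X n)) * dominator a (u, z)"
        using K(2)[of 0 u z "X n"] by simp
      also have "\<dots> \<le> K * exp R * dominator a (u, z)"
        using K(1) R by (intro mult_right_mono mult_left_mono) auto
      finally show "norm (w u * \<psi> z * g (u *\<^sub>R X n + sqrt (1 - u\<^sup>2) *\<^sub>R z)) \<le> K * exp R * dominator a (u, z)" .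
    qed
  qed (use int integrable_dominator in auto)
qed

text \<open>Translating z moves the dependence on x from g to \<psi>, so g need not be differentiable; the price is the factor u / sqrt (1 - u^2), bounded only for u \<le> a < 1.\<close>
lemma has_partial_ou_avg:
  fixes \<psi> g :: "real^'n::finite \<Rightarrow> real"
  assumes "a < 1" "weight a w" "gauss_poly \<psi>" "exp_growth g" "gauss_poly \<eta>" "has_partial j \<psi> \<eta>"
  shows "has_partial j (ou_avg w \<psi> g) (ou_avg (\<lambda>u. w u * (u / sqrt (1 - u\<^sup>2))) (\<lambda>z. - \<eta> z) g)"
  unfolding has_partial_def
proof
  fix x :: "real^'n"
  \<comment> \<open>The shift of z that compensates a shift of x by t along axis j: for u in [0, a],
    sqrt (1 - u^2) times \<open>c t u\<close> equals u t e_j, so the argument of g no longer depends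
    on t.\<close>
  define c where "c t u = (u * t / sqrt (1 - u\<^sup>2)) *\<^sub>R axis j (1::real)" for t u
  define w' where "w' u = w u * (u / sqrt (1 - u\<^sup>2))" for u
  define B where "B = 1 / sqrt (1 - a\<^sup>2)"
  have w': "weight a w'" unfolding w'_def by (rule weight_mult_quotient[OF assms(2,1)])
  have cB: "norm (c t u) \<le> \<bar>t\<bar> * B" if "u \<in> {0..a}" for t u
    using mult_left_mono[OF sqrt_one_minus_bounds(3)[OF that assms(1)], of "\<bar>t\<bar>"]
    by (simp add: c_def B_def abs_mult mult.commute)
  have B: "0 \<le> B" if "u \<in> {0..a}" for u using cB[OF that, of 1] norm_ge_zero[of "c 1 u"] by linarith
  have cm[measurable]: "c t \<in> borel_measurable borel" for t unfolding c_def by measurable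
  obtain K where K: "0 \<le> K" "\<And>x u z v. norm v \<le> \<bar>B\<bar> \<Longrightarrow>
    \<bar>w' u * \<eta> (z - v) * g (u *\<^sub>R x + sqrt (1 - u\<^sup>2) *\<^sub>R z)\<bar> \<le> K * exp (norm x) * dominator a (u, z)"
    using ou_integrand_bound[OF assms(1) w' assms(5,4), of "\<bar>B\<bar>"] by auto
  define F where "F t = (\<lambda>(u, z). w u * \<psi> (z - c t u) * g (u *\<^sub>R x + sqrt (1 - u\<^sup>2) *\<^sub>R z))" for t
  define F' where "F' t = (\<lambda>(u, z). - (w' u * \<eta> (z - c t u) * g (u *\<^sub>R x + sqrt (1 - u\<^sup>2) *\<^sub>R z)))" for t
  have Fint: "integrable (lborel \<Otimes>\<^sub>M lborel) (F t)" for t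
    unfolding F_def by (rule ou_integrand_integrable[OF assms(1-4) cm cB])
  have eq: "ou_avg w \<psi> g (x + t *\<^sub>R axis j 1) = integral\<^sup>L (lborel \<Otimes>\<^sub>M lborel) (F t)" for t
  proof -
    let ?f = "\<lambda>(u, z). w u * \<psi> z * g (u *\<^sub>R (x + t *\<^sub>R axis j 1) + sqrt (1 - u\<^sup>2) *\<^sub>R z)"
    have "F t (u, z) = ?f (u, z + (- c t u))" for u z
      proof (cases "u \<in> {0..a}")
        case True
        have "sqrt (1 - u\<^sup>2) \<noteq> 0" using sqrt_one_minus_bounds(1)[OF True assms(1)] by simp
        then show ?thesis by (simp add: F_def c_def algebra_simps)
      qed (use weight_zero[OF assms(2)] in \<open>simp add: F_def\<close>)
    then have F_eq: "F t = (\<lambda>(u, z). ?f (u, z + (- c t u)))" by (simp add: fun_eq_iff)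
    have "integrable (lborel \<Otimes>\<^sub>M lborel) ?f"
      using ou_integrand_integrable[OF assms(1-4), of "\<lambda>_. 0" 0] by simp
    from lborel_pair_integral_shear[OF this, of "\<lambda>u. - c t u"] Fint[of t]
    show ?thesis unfolding F_eq ou_avg_def by simp
  qed
  have "((\<lambda>t. \<integral>p. F t p \<partial>(lborel \<Otimes>\<^sub>M lborel)) has_real_derivative (\<integral>p. F' 0 p \<partial>(lborel \<Otimes>\<^sub>M lborel))) (at 0)"
  proof (rule has_real_derivative_integral[OF Fint, where D = "\<lambda>p. K * exp (norm x) * dominator a p"])
    show "F' 0 \<in> borel_measurable (lborel \<Otimes>\<^sub>M lborel)"
      unfolding F'_def
      using borel_measurable_integrable[OF ou_integrand_integrable[OF assms(1) w' assms(5,4) cm cB, of 0 x]]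
      by (simp add: split_beta')
    show "integrable (lborel \<Otimes>\<^sub>M lborel) (\<lambda>p :: real \<times> (real^'n). K * exp (norm x) * dominator a p)"
      by (simp add: integrable_dominator)
    show "\<bar>F' t p\<bar> \<le> K * exp (norm x) * dominator a p" if t: "\<bar>t\<bar> < 1" for t p
    proof (cases p)
      case (Pair u z)
      show ?thesis
      proof (cases "u \<in> {0..a}")
        case True
        have "norm (c t u) \<le> \<bar>t\<bar> * B" by (rule cB[OF True])
        also have "\<dots> \<le> 1 * B" using t B[OF True] by (intro mult_right_mono) auto
        finally have "norm (c t u) \<le> \<bar>B\<bar>" using B[OF True] by simp
        from K(2)[OF this, of u z x] show ?thesis by (simp add: F'_def Pair)
      qed (use weight_zero[OF w'] K(1) in \<open>simp add: F'_def Pair\<close>)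
    qed
    show "((\<lambda>r. F r p) has_real_derivative F' t p) (at t)" if t: "\<bar>t\<bar> < 1" for t p
    proof (cases p)
      case (Pair u z)
      \<comment> \<open>Differentiating \<psi> along the shift produces - q; the factor q goes into
        the weight and the sign into the new \<psi>.\<close>
      define q where "q = u / sqrt (1 - u\<^sup>2)"
      have "((\<lambda>r. \<psi> (z + (- r * q) *\<^sub>R axis j 1)) has_real_derivative \<eta> (z + (- t * q) *\<^sub>R axis j 1) * (- q)) (at t)"
        by (rule DERIV_chain2[OF has_partialD[OF assms(6)]]) (auto intro!: derivative_eq_intros)
      moreover have "z + (- r * q) *\<^sub>R axis j 1 = z - c r u" for r by (simp add: c_def q_def mult.commute)
      ultimately have "((\<lambda>r. \<psi> (z - c r u)) has_real_derivative \<eta> (z - c t u) * (- q)) (at t)" by simp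
      then show ?thesis unfolding F_def F'_def Pair w'_def
        by (auto intro!: derivative_eq_intros simp: q_def)
    qed
  qed
  moreover have "(\<integral>p. F' 0 p \<partial>(lborel \<Otimes>\<^sub>M lborel)) = ou_avg w' (\<lambda>z. - \<eta> z) g x"
    unfolding ou_avg_def F'_def c_def by simp
  ultimately show "((\<lambda>t. ou_avg w \<psi> g (x + t *\<^sub>R axis j 1)) has_real_derivative
     ou_avg (\<lambda>u. w u * (u / sqrt (1 - u\<^sup>2))) (\<lambda>z. - \<eta> z) g x) (at 0)"
    unfolding eq w'_def by simp
qed

text \<open>The counterpart in which the derivative falls on g: it costs only the factor u and
  leaves \<psi> alone, but uses up a derivative of g.\<close>

lemma has_partial_ou_avg':
  fixes \<psi> g :: "real^'n::finite \<Rightarrow> real"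
  assumes "a < 1" "weight a w" "gauss_poly \<psi>" "exp_growth g" "exp_growth g'" "has_partial j g g'"
  shows "has_partial j (ou_avg w \<psi> g) (ou_avg (\<lambda>u. w u * u) \<psi> g')"
  unfolding has_partial_def
proof
  fix x :: "real^'n"
  have w': "weight a (\<lambda>u. w u * u)" by (rule weight_mult_id[OF assms(2)])
  obtain K where K: "0 \<le> K" "\<And>x u z v. norm v \<le> 0 \<Longrightarrow>
    \<bar>w u * u * \<psi> (z - v) * g' (u *\<^sub>R x + sqrt (1 - u\<^sup>2) *\<^sub>R z)\<bar> \<le> K * exp (norm x) * dominator a (u, z)"
    using ou_integrand_bound[OF assms(1) w' assms(3,5), of 0] by auto
  define F where "F t = (\<lambda>(u, z). w u * \<psi> z * g (u *\<^sub>R (x + t *\<^sub>R axis j 1) + sqrt (1 - u\<^sup>2) *\<^sub>R z))" for t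
  define F' where "F' t = (\<lambda>(u, z). w u * u * \<psi> z * g' (u *\<^sub>R (x + t *\<^sub>R axis j 1) + sqrt (1 - u\<^sup>2) *\<^sub>R z))" for t
  have "((\<lambda>t. \<integral>p. F t p \<partial>(lborel \<Otimes>\<^sub>M lborel)) has_real_derivative (\<integral>p. F' 0 p \<partial>(lborel \<Otimes>\<^sub>M lborel))) (at 0)"
  proof (rule has_real_derivative_integral[where D = "\<lambda>p. K * exp (norm x + 1) * dominator a p"])
    show "integrable (lborel \<Otimes>\<^sub>M lborel) (F t)" for t
      unfolding F_def using ou_integrand_integrable[OF assms(1-4), of "\<lambda>_. 0" 0] by simp
    show "F' 0 \<in> borel_measurable (lborel \<Otimes>\<^sub>M lborel)"
      unfolding F'_def
      using borel_measurable_integrable[OF ou_integrand_integrable[OF assms(1) w' assms(3,5), of "\<lambda>_. 0" 0 x]]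
      by simp
    show "integrable (lborel \<Otimes>\<^sub>M lborel) (\<lambda>p :: real \<times> (real^'n). K * exp (norm x + 1) * dominator a p)"
      by (simp add: integrable_dominator)
    show "\<bar>F' t p\<bar> \<le> K * exp (norm x + 1) * dominator a p" if t: "\<bar>t\<bar> < 1" for t p
    proof (cases p)
      case (Pair u z)
      have "norm (x + t *\<^sub>R axis j 1) \<le> norm x + 1"
        using t by (intro norm_triangle_le) simp
      then have "K * exp (norm (x + t *\<^sub>R axis j 1)) * dominator a p \<le> K * exp (norm x + 1) * dominator a p"
        using K(1) by (intro mult_right_mono mult_left_mono) auto
      with K(2)[of 0 u z "x + t *\<^sub>R axis j 1"] show ?thesis by (simp add: F'_def Pair)
    qed
    show "((\<lambda>r. F r p) has_real_derivative F' t p) (at t)" if t: "\<bar>t\<bar> < 1" for t p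
    proof (cases p)
      case (Pair u z)
      let ?y = "u *\<^sub>R x + sqrt (1 - u\<^sup>2) *\<^sub>R z"
      have "((\<lambda>r. g (?y + (r * u) *\<^sub>R axis j 1)) has_real_derivative g' (?y + (t * u) *\<^sub>R axis j 1) * u) (at t)"
        by (rule DERIV_chain2[OF has_partialD[OF assms(6)]]) (auto intro!: derivative_eq_intros)
      moreover have "?y + (r * u) *\<^sub>R axis j 1 = u *\<^sub>R (x + r *\<^sub>R axis j 1) + sqrt (1 - u\<^sup>2) *\<^sub>R z" for r
        by (simp add: algebra_simps)
      ultimately have "((\<lambda>r. g (u *\<^sub>R (x + r *\<^sub>R axis j 1) + sqrt (1 - u\<^sup>2) *\<^sub>R z)) has_real_derivative
         g' (u *\<^sub>R (x + t *\<^sub>R axis j 1) + sqrt (1 - u\<^sup>2) *\<^sub>R z) * u) (at t)" by simp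
      then show ?thesis unfolding F_def F'_def Pair
        by (auto intro!: derivative_eq_intros)
    qed
  qed
  then show "((\<lambda>t. ou_avg w \<psi> g (x + t *\<^sub>R axis j 1)) has_real_derivative
     ou_avg (\<lambda>u. w u * u) \<psi> g' x) (at 0)"
    unfolding ou_avg_def F_def F'_def by simp
qed

text \<open>All derivatives are placed on \<psi>, so a merely continuous g of exponential growth
  gives every order. Each of them multiplies the weight by u / sqrt (1 - u^2), which is bounded on
  [0, a].\<close>

lemma Ck_ou_avg:
  assumes "a < 1" "weight a w" "gauss_poly \<psi>" "exp_growth g"
  shows "Ck m (ou_avg w \<psi> g)"
proof -
  have "\<exists>w' \<psi>'. weight a w' \<and> gauss_poly \<psi>' \<and> pd js (ou_avg w \<psi> g) = ou_avg w' \<psi>' g" for js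
  proof (induction js)
    case (Cons j js)
    then obtain w' \<psi>' where IH: "weight a w'" "gauss_poly \<psi>'" "pd js (ou_avg w \<psi> g) = ou_avg w' \<psi>' g" by blast
    obtain \<eta> where "gauss_poly \<eta>" "has_partial j \<psi>' \<eta>" using gauss_poly_partial IH(2) by blast
    with IH show ?case
      using partial_eq[OF has_partial_ou_avg[OF assms(1) IH(1,2) assms(4)]]
        weight_mult_quotient[OF IH(1) assms(1)] gauss_poly_uminus by (metis pd.simps(2))
  qed (use assms in auto)
  moreover have "(\<lambda>t. ou_avg w' \<psi>' g (x + t *\<^sub>R axis j 1)) differentiable (at 0)"
    if "weight a w'" "gauss_poly \<psi>'" for w' \<psi>' j x
    using gauss_poly_partial[OF that(2), of j] has_partial_ou_avg[OF assms(1) that assms(4)]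
    by (auto simp: has_partial_def real_differentiable_def)
  moreover have "continuous_on UNIV (ou_avg w' \<psi>' g)" if "weight a w'" "gauss_poly \<psi>'" for w' \<psi>'
    using ou_avg_continuous[OF assms(1) that assms(4)] .
  ultimately show ?thesis unfolding Ck_def by metis
qed

section \<open>Growth bounds and Gaussian moments\<close>

lemma has_real_derivative_along_curve:
  fixes g :: "real^'n::finite \<Rightarrow> real"
  assumes part: "\<And>j. has_partial j g (g' j)" and cont: "\<And>j. continuous_on UNIV (g' j)"
    and \<gamma>: "(\<gamma> has_vector_derivative v) (at t)"
  shows "((\<lambda>t. g (\<gamma> t)) has_real_derivative (\<Sum>j\<in>UNIV. v $ j * g' j (\<gamma> t))) (at t)"
proof -
  have "(g has_derivative (\<lambda>h. \<Sum>j\<in>UNIV. h $ j * g' j (\<gamma> t))) (at (\<gamma> t))"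
    using has_derivative_continuous_partials[OF _ cont] part by (simp add: has_partial_def)
  from has_derivative_compose[OF \<gamma>[unfolded has_vector_derivative_def] this]
  show ?thesis
    unfolding has_field_derivative_def
    by (rule has_derivative_eq_rhs) (simp add: fun_eq_iff sum_distrib_left sum_distrib_right mult_ac)
qed

definition poly_growth :: "nat \<Rightarrow> (real^'n::finite \<Rightarrow> real) \<Rightarrow> bool" where
  "poly_growth m g \<longleftrightarrow> continuous_on UNIV g \<and> (\<exists>C. \<forall>y. \<bar>g y\<bar> \<le> C * (1 + norm y) ^ m)"

text \<open>Mean value theorem on the segment from 0 to y: the factor |y| raises the degree by
  one.\<close>

lemma poly_growth_integrate:
  fixes g :: "real^'n::finite \<Rightarrow> real"
  assumes part: "\<And>j. has_partial j g (g' j)" and growth: "\<And>j. poly_growth m (g' j)"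
    and cont: "continuous_on UNIV g"
  shows "poly_growth (Suc m) g"
proof -
  obtain C where C: "\<And>j y. \<bar>g' j y\<bar> \<le> C j * (1 + norm y) ^ m"
    using growth unfolding poly_growth_def by metis
  have cont': "continuous_on UNIV (g' j)" for j using growth by (simp add: poly_growth_def)
  have Cpos: "0 \<le> C j" for j using C[of j 0] by simp
  define K where "K = (\<Sum>j\<in>UNIV. C j)"
  have Kpos: "0 \<le> K" unfolding K_def using Cpos by (intro sum_nonneg) auto
  have "\<bar>g y\<bar> \<le> (\<bar>g 0\<bar> + K) * (1 + norm y) ^ Suc m" for y
  proof -
    have der: "((\<lambda>t. g (t *\<^sub>R y)) has_real_derivative (\<Sum>j\<in>UNIV. y $ j * g' j (t *\<^sub>R y))) (at t)" for t
      by (rule has_real_derivative_along_curve[OF part cont']) (auto intro!: derivative_eq_intros)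
    from MVT2[of 0 1, OF _ this]
    obtain t where t: "0 < t" "t < 1" "g y - g 0 = (\<Sum>j\<in>UNIV. y $ j * g' j (t *\<^sub>R y))" by auto
    have "\<bar>g y - g 0\<bar> \<le> (\<Sum>j\<in>UNIV. norm y * (C j * (1 + norm y) ^ m))"
      unfolding t(3)
    proof (rule order_trans[OF sum_abs sum_mono])
      fix j
      have "norm (t *\<^sub>R y) \<le> norm y" using t by (simp add: mult_left_le_one_le)
      then have "C j * (1 + norm (t *\<^sub>R y)) ^ m \<le> C j * (1 + norm y) ^ m"
        using Cpos by (intro mult_left_mono power_mono) auto
      then have "\<bar>g' j (t *\<^sub>R y)\<bar> \<le> C j * (1 + norm y) ^ m" using C by (rule order_trans[rotated])
      then show "\<bar>y $ j * g' j (t *\<^sub>R y)\<bar> \<le> norm y * (C j * (1 + norm y) ^ m)"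
        unfolding abs_mult using component_le_norm_cart by (intro mult_mono) auto
    qed
    also have "\<dots> = K * (norm y * (1 + norm y) ^ m)"
      by (simp add: K_def sum_distrib_left sum_distrib_right mult_ac)
    also have "\<dots> \<le> K * ((1 + norm y) * (1 + norm y) ^ m)"
      using Kpos by (intro mult_left_mono mult_right_mono) auto
    finally have 1: "\<bar>g y - g 0\<bar> \<le> K * (1 + norm y) ^ Suc m" by simp
    have "\<bar>g 0\<bar> * 1 \<le> \<bar>g 0\<bar> * (1 + norm y) ^ Suc m"
      by (intro mult_left_mono one_le_power) auto
    with 1 show ?thesis unfolding distrib_right by linarith
  qed
  with cont show ?thesis unfolding poly_growth_def by blast
qed

lemma exp_growth_one_plus_norm_power: "exp_growth (\<lambda>y::real^'n::finite. (1 + norm y) ^ m)"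
proof -
  have "\<bar>(1 + norm y) ^ m\<bar> \<le> (1 + real m) ^ m * exp (norm y)" for y :: "real^'n"
  proof (cases "m = 0")
    case False
    \<comment> \<open>With s = |y|, the inequalities 1 + s <= (1 + m) (1 + s / m) and (1 + s / m)^m
      <= exp s give the constant (1 + m)^m.\<close>
    have "1 + norm y \<le> (1 + real m) * (1 + norm y / m)" using False by (simp add: field_simps)
    then have "(1 + norm y) ^ m \<le> ((1 + real m) * (1 + norm y / m)) ^ m" by (intro power_mono) auto
    also have "\<dots> \<le> (1 + real m) ^ m * exp (norm y)"
      unfolding power_mult_distrib
      using exp_ge_one_plus_x_over_n_power_n[of m "norm y"] False norm_ge_zero[of y]
      by (intro mult_left_mono) (auto simp del: norm_ge_zero)
    finally show ?thesis by simp
  qed simp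
  then show ?thesis unfolding exp_growth_def by (auto intro!: continuous_intros)
qed

lemma exp_growth_const: "exp_growth (\<lambda>_. c)"
proof -
  have "\<bar>c\<bar> \<le> \<bar>c\<bar> * exp (norm y)" for y :: "real^'a" 
    using mult_left_mono[of 1 "exp (norm y)" "\<bar>c\<bar>"] by simp
  then show ?thesis unfolding exp_growth_def by auto
qed

lemma poly_growth_imp_exp_growth:
  assumes "poly_growth m g"
  shows "exp_growth g"
proof -
  obtain C where C: "\<And>y. \<bar>g y\<bar> \<le> C * (1 + norm y) ^ m" using assms by (auto simp: poly_growth_def)
  obtain D where D: "\<And>y::real^'a. \<bar>(1 + norm y) ^ m\<bar> \<le> D * exp (norm y)"
    using exp_growth_one_plus_norm_power[of m] by (auto simp: exp_growth_def)
  have "\<bar>g y\<bar> \<le> (\<bar>C\<bar> * D) * exp (norm y)" for y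
  proof -
    have "\<bar>g y\<bar> \<le> \<bar>C\<bar> * \<bar>(1 + norm y) ^ m\<bar>" 
      using C[of y] by (metis abs_ge_self abs_mult order_trans)
    also have "\<dots> \<le> \<bar>C\<bar> * (D * exp (norm y))" using D by (intro mult_left_mono) auto
    finally show ?thesis by (simp add: mult.assoc)
  qed
  with assms show ?thesis unfolding exp_growth_def poly_growth_def by blast
qed

section \<open>Tensor norms and the growth of the derivatives of a test function\<close>

lemma finite_lists_length [simp]: "finite {is :: 'n::finite list. length is = k}"
  using finite_lists_length_eq[of "UNIV :: 'n set" k] by simp

lemma tnorm_nonneg [simp]: "0 \<le> tnorm k A"
  by (simp add: tnorm_def tinner_def sum_nonneg)

lemma tnorm_sq: "(tnorm k A)\<^sup>2 = (\<Sum>is\<in>{is. length is = k}. (A is)\<^sup>2)"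
  by (simp add: tnorm_def tinner_def sum_nonneg power2_eq_square)

lemma abs_entry_le_tnorm:
  assumes "length is = k"
  shows "\<bar>A is\<bar> \<le> tnorm k A"
proof (rule power2_le_imp_le)
  show "\<bar>A is\<bar>\<^sup>2 \<le> (tnorm k A)\<^sup>2"
    unfolding tnorm_sq power2_abs using assms by (intro member_le_sum) auto
qed simp

lemma Ck_has_partial:
  assumes "Ck k f" "length js < k"
  shows "has_partial j (pd js f) (pd (j # js) f)"
  using assms unfolding Ck_def has_partial_def pd.simps partial_def
  by (metis DERIV_deriv_iff_real_differentiable)

text \<open>Induction downwards from order k, where an entry of the derivative tensor is at most its
  norm, hence at most 1; each derivative that is removed costs one more power of 1 + |y|. For
  \<open>js = []\<close> this bounds f itself by degree k.\<close>

lemma pd_poly_growth: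
  assumes f: "Ck k f" "\<And>x. tnorm k (Dk_scalar k f x) \<le> 1"
  shows "length js + m = k \<Longrightarrow> poly_growth m (pd js f)"
proof (induction m arbitrary: js)
  case 0
  then have "\<bar>pd js f y\<bar> \<le> 1" for y
    using abs_entry_le_tnorm[of js k "Dk_scalar k f y"] f(2)[of y] by (simp add: Dk_scalar_def)
  then show ?case using f(1) 0 by (auto simp: poly_growth_def Ck_def intro!: exI[of _ 1])
next
  case (Suc m)
  show ?case
  proof (rule poly_growth_integrate)
    show "has_partial j (pd js f) (pd (j # js) f)" for j
      using Ck_has_partial[OF f(1)] Suc.prems by simp
    show "poly_growth m (pd (j # js) f)" for j using Suc.IH[of "j # js"] Suc.prems by simp
    show "continuous_on UNIV (pd js f)" using f(1) Suc.prems by (simp add: Ck_def)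
  qed
qed

section \<open>Gaussian integration by parts and second moments\<close>

lemma gauss_poly_integrable:
  fixes \<psi> g :: "real^'n::finite \<Rightarrow> real"
  assumes "gauss_poly \<psi>" "exp_growth g"
  shows "integrable lborel (\<lambda>z. \<psi> z * g z)"
proof -
  define N where "N = real CARD('n) + 1"
  obtain C where C: "C \<ge> 0" "\<And>z. \<bar>\<psi> z\<bar> \<le> C * exp (- N * norm z)" using gauss_poly_bound[OF assms(1)] by blast
  obtain D where D: "\<And>y. \<bar>g y\<bar> \<le> D * exp (norm y)" using assms(2) by (auto simp: exp_growth_def)
  have Dpos: "0 \<le> D" using D[of 0] by simp
  have [measurable]: "\<psi> \<in> borel_measurable borel" "g \<in> borel_measurable borel"
    using assms(2) gauss_poly_continuous[OF assms(1)]
    by (auto simp: exp_growth_def intro: borel_measurable_continuous_onI)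
  show ?thesis
  proof (rule Bochner_Integration.integrable_bound)
    show "integrable lborel (\<lambda>z::real^'n. (C * D) * exp (- real CARD('n) * norm z))"
      by (intro integrable_mult_right integrable_exp_norm)
    show "AE z in lborel. norm (\<psi> z * g z) \<le> norm ((C * D) * exp (- real CARD('n) * norm z))"
    proof (rule AE_I2)
      fix z
      have "\<bar>\<psi> z * g z\<bar> \<le> (C * exp (- N * norm z)) * (D * exp (norm z))"
        unfolding abs_mult using C D by (intro mult_mono) auto
      also have "\<dots> = (C * D) * exp (- real CARD('n) * norm z)"
        by (simp add: N_def algebra_simps flip: exp_add)
      finally show "norm (\<psi> z * g z) \<le> norm ((C * D) * exp (- real CARD('n) * norm z))"
        using C(1) Dpos by simp
    qed
  qed measurable
qed

lemma gauss_poly_integrable': "gauss_poly \<psi> \<Longrightarrow> integrable lborel \<psi>"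
  using gauss_poly_integrable[OF _ exp_growth_const[of 1]] by simp

text \<open>By translation invariance the integral of \<psi> (z + t e_j) does not depend on t, so
  its derivative at 0 vanishes. This takes the place of boundary terms at infinity.\<close>

lemma integral_partial_gauss_poly:
  fixes \<psi> \<eta> :: "real^'n::finite \<Rightarrow> real"
  assumes "gauss_poly \<psi>" "gauss_poly \<eta>" "has_partial j \<psi> \<eta>"
  shows "(\<integral>z. \<eta> z \<partial>lborel) = 0"
proof -
  define N where "N = real CARD('n)"
  obtain C where C: "C \<ge> 0" "\<And>z. \<bar>\<eta> z\<bar> \<le> C * exp (- N * norm z)" using gauss_poly_bound[OF assms(2)] by blast
  have [measurable]: "\<psi> \<in> borel_measurable borel" "\<eta> \<in> borel_measurable borel"
    using gauss_poly_continuous assms(1,2) by (auto intro: borel_measurable_continuous_onI)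
  have "((\<lambda>t. \<integral>z. \<psi> (z + t *\<^sub>R axis j 1) \<partial>lborel) has_real_derivative (\<integral>z. \<eta> (z + 0 *\<^sub>R axis j 1) \<partial>lborel)) (at 0)"
  proof (rule has_real_derivative_integral[where D = "\<lambda>z. (C * exp N) * exp (- N * norm z)"])
    show "integrable lborel (\<lambda>z. \<psi> (z + t *\<^sub>R axis j 1))" for t
      by (simp add: lborel_integrable_translate gauss_poly_integrable' assms)
    show "((\<lambda>r. \<psi> (z + r *\<^sub>R axis j 1)) has_real_derivative \<eta> (z + t *\<^sub>R axis j 1)) (at t)" for t z
      by (rule has_partialD[OF assms(3)])
    show "integrable lborel (\<lambda>z::real^'n. (C * exp N) * exp (- N * norm z))"
      unfolding N_def by (intro integrable_mult_right integrable_exp_norm)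
    show "\<bar>\<eta> (z + t *\<^sub>R axis j 1)\<bar> \<le> (C * exp N) * exp (- N * norm z)" if t: "\<bar>t\<bar> < 1" for t z
    proof -
      have "norm z - 1 \<le> norm (z + t *\<^sub>R axis j 1)"
        using norm_triangle_ineq4[of "z + t *\<^sub>R axis j 1" "t *\<^sub>R axis j 1"] t by simp
      then have "N * (norm z - 1) \<le> N * norm (z + t *\<^sub>R axis j 1)" by (rule mult_left_mono) (simp add: N_def)
      then have "exp (- N * norm (z + t *\<^sub>R axis j 1)) \<le> exp N * exp (- N * norm z)"
        by (simp add: algebra_simps flip: exp_add)
      from mult_left_mono[OF this C(1)] C(2)[of "z + t *\<^sub>R axis j 1"] show ?thesis
        by (simp add: mult.assoc)
    qed
  qed simp
  moreover have "((\<lambda>t. \<integral>z. \<psi> (z + t *\<^sub>R axis j 1) \<partial>lborel) has_real_derivative 0) (at 0)"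
    by (simp add: lborel_integral_translate)
  ultimately show ?thesis using DERIV_unique by fastforce
qed

text \<open>Integration by parts with \<open>z $ i * gauss_dens z\<close>. The total mass is kept as
  a factor; its value is read off later from the moment hypothesis.\<close>

lemma gauss_second_moment:
  fixes i j :: "'n::finite"
  shows "(\<integral>z. z $ i * (z $ j * gauss_dens z) \<partial>lborel)
     = (if i = j then (\<integral>z. gauss_dens (z :: real^'n) \<partial>lborel) else 0)"
proof -
  define \<eta> where "\<eta> z = (if i = j then 1 else 0) * gauss_dens z + (-1) * (z $ i * (z $ j * gauss_dens z))" for z :: "real^'n"
  have *: "gauss_poly (\<lambda>z. z $ i * (z $ j * gauss_dens z))" by (intro gauss_poly.intros)
  have "gauss_poly \<eta>" unfolding \<eta>_def by (intro gauss_poly.intros)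
  moreover have "has_partial j (\<lambda>z. z $ i * gauss_dens z) \<eta>"
    using has_partial_coord[OF has_partial_gauss_dens[of j], of i] by (simp add: \<eta>_def[abs_def])
  ultimately have "(\<integral>z. \<eta> z \<partial>lborel) = 0"
    using integral_partial_gauss_poly gauss_poly.intros by blast
  then show ?thesis unfolding \<eta>_def
    using gauss_poly_integrable'[OF *] gauss_poly_integrable'[OF gauss_poly.dens, where 'a = 'n]
    by (auto split: if_splits)
qed

lemma gauss_poly_scale: "gauss_poly \<psi> \<Longrightarrow> gauss_poly (\<lambda>z. c * \<psi> z)"
  using gauss_poly.lincomb[of \<psi> \<psi> c 0] by simp

lemma gauss_poly_sum:
  assumes "finite S" "\<And>i. i \<in> S \<Longrightarrow> gauss_poly (\<psi> i)"
  shows "gauss_poly (\<lambda>z. \<Sum>i\<in>S. \<psi> i z)"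
  using assms
proof (induction rule: finite_induct)
  case empty
  show ?case using gauss_poly_scale[OF gauss_poly.dens, of 0] by simp
next
  case (insert i S)
  then show ?case using gauss_poly.lincomb[of "\<psi> i" "\<lambda>z. \<Sum>i\<in>S. \<psi> i z" 1 1] by simp
qed

text \<open>The square is expanded and the mixed terms vanish by orthogonality of the coordinates.
  The first conclusion supplies integrability wherever the second is used.\<close>

lemma gauss_integral_linear_form_sq:
  fixes b :: "'n::finite \<Rightarrow> real"
  shows "gauss_poly (\<lambda>z. (\<Sum>j\<in>UNIV. b j * z $ j)\<^sup>2 * gauss_dens z)" (is ?P)
    and "(\<integral>z. (\<Sum>j\<in>UNIV. b j * z $ j)\<^sup>2 * gauss_dens z \<partial>lborel)
      = (\<Sum>j\<in>UNIV. (b j)\<^sup>2) * (\<integral>z. gauss_dens (z :: real^'n) \<partial>lborel)" (is ?Q)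
proof -
  have eq: "(\<Sum>j\<in>UNIV. b j * z $ j)\<^sup>2 * gauss_dens z
      = (\<Sum>i\<in>UNIV. \<Sum>j\<in>UNIV. (b i * b j) * (z $ i * (z $ j * gauss_dens z)))" for z :: "real^'n"
    by (simp add: power2_eq_square sum_product sum_distrib_left sum_distrib_right mult_ac)
  have gp: "gauss_poly (\<lambda>z::real^'n. (b i * b j) * (z $ i * (z $ j * gauss_dens z)))" for i j
    by (intro gauss_poly_scale gauss_poly.intros)
  show ?P unfolding eq by (rule gauss_poly_sum, simp, rule gauss_poly_sum, simp, rule gp)
  have "(\<integral>z. (\<Sum>j\<in>UNIV. b j * z $ j)\<^sup>2 * gauss_dens z \<partial>lborel)
    = (\<Sum>i\<in>UNIV. \<Sum>j\<in>UNIV. \<integral>z. (b i * b j) * (z $ i * (z $ j * gauss_dens (z::real^'n))) \<partial>lborel)"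
    unfolding eq
    by (subst Bochner_Integration.integral_sum, rule gauss_poly_integrable',
        rule gauss_poly_sum, simp, rule gp, intro sum.cong refl Bochner_Integration.integral_sum)
      (rule gauss_poly_integrable'[OF gp])
  also have "\<dots> = (\<Sum>i\<in>UNIV. (b i)\<^sup>2 * (\<integral>z. gauss_dens (z :: real^'n) \<partial>lborel))"
    by (simp add: gauss_second_moment power2_eq_square if_distrib[of "\<lambda>x. _ * x"] cong: if_cong)
  finally show ?Q by (simp add: sum_distrib_right)
qed

section \<open>The generator identity and the pairing bound\<close>

lemma gauss_dens_nonneg: "0 \<le> gauss_dens z"
  by (simp add: gauss_dens_def)

lemma weight_indicator: "weight a (indicator {0..a})"
  unfolding weight_def by (auto intro!: exI[of _ 1])

lemma weight_indicator_power:
  assumes "a < 1"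
  shows "weight a (\<lambda>u. indicator {0..a} u * u ^ n)"
  by (rule weight_mult[OF weight_indicator, where B = 1]) (use assms in \<open>auto intro!: power_le_one\<close>)

text \<open>The antiderivative of u / sqrt (1 - u^2) is - sqrt (1 - u^2), and u^n <= 1. The bound
  does not see a, which is what lets a tend to 1 at the end.\<close>

lemma integral_ou_quotient_le:
  assumes "0 \<le> a" "a < 1"
  shows "(\<integral>u. indicator {0..a} u * u ^ n * (u / sqrt (1 - u\<^sup>2)) \<partial>lborel) \<le> 1"
proof -
  let ?q = "\<lambda>u::real. u / sqrt (1 - u\<^sup>2)"
  have der: "DERIV (\<lambda>u. - sqrt (1 - u\<^sup>2)) u :> ?q u" if "0 \<le> u" "u \<le> a" for u
  proof -
    have "1 - u\<^sup>2 > 0" using sqrt_one_minus_bounds(1)[of u a] that assms by simp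
    then show ?thesis by (auto intro!: derivative_eq_intros simp: field_simps)
  qed
  have cont: "isCont ?q u" if "0 \<le> u" "u \<le> a" for u
    using sqrt_one_minus_bounds(1)[of u a] that assms by (intro continuous_intros) auto
  have b: "has_bochner_integral lborel (\<lambda>u. ?q u * indicator {0..a} u) (- sqrt (1 - a\<^sup>2) - (- sqrt (1 - 0\<^sup>2)))"
    using has_bochner_integral_FTC_Icc_real[OF assms(1) der cont] .
  have "(\<integral>u. indicator {0..a} u * u ^ n * ?q u \<partial>lborel) \<le> (\<integral>u. ?q u * indicator {0..a} u \<partial>lborel)"
  proof (rule integral_mono')
    show "integrable lborel (\<lambda>u. ?q u * indicator {0..a} u)" using b by (simp add: has_bochner_integral_iff)
    fix u :: real
    show "0 \<le> ?q u * indicator {0..a} u"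
      using sqrt_one_minus_bounds(1)[of u a] assms by (cases "u \<in> {0..a}") auto
    show "indicator {0..a} u * u ^ n * ?q u \<le> ?q u * indicator {0..a} u"
    proof (cases "u \<in> {0..a}")
      case True
      then have "u ^ n * ?q u \<le> 1 * ?q u"
        using sqrt_one_minus_bounds(1)[of u a] assms by (intro mult_right_mono power_le_one) auto
      then show ?thesis using True by simp
    qed simp
  qed
  also have "\<dots> = 1 - sqrt (1 - a\<^sup>2)" using b by (simp add: has_bochner_integral_iff)
  also have "\<dots> \<le> 1" using sqrt_one_minus_bounds(1)[of a a] assms by simp
  finally show ?thesis .
qed

text \<open>For fixed z the combined integrand is the density times the u-derivative of f (u x +
  sqrt (1 - u^2) z), because the curve has velocity x - u / sqrt (1 - u^2) z. Integrating in u first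
  leaves the values at the end points, and the curve starts at z. The second sum is the divergence
  in the form in which \<open>has_partial_ou_avg\<close> yields it.\<close>

lemma ou_avg_generator:
  fixes f :: "real^'n::finite \<Rightarrow> real"
  assumes a: "0 \<le> a" "a < 1" and f: "exp_growth f"
    and part: "\<And>i. has_partial i f (f' i)" and f': "\<And>i. exp_growth (f' i)"
  shows "(\<Sum>i\<in>UNIV. x $ i * ou_avg (indicator {0..a}) gauss_dens (f' i) x)
     - (\<Sum>i\<in>UNIV. ou_avg (\<lambda>u. indicator {0..a} u * (u / sqrt (1 - u\<^sup>2))) (\<lambda>z. z $ i * gauss_dens z) (f' i) x)
     = (\<integral>z. gauss_dens z * (f (a *\<^sub>R x + sqrt (1 - a\<^sup>2) *\<^sub>R z) - f z) \<partial>lborel)"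
proof -
  let ?M = "lborel \<Otimes>\<^sub>M lborel :: (real \<times> (real^'n)) measure"
  let ?q = "\<lambda>u::real. u / sqrt (1 - u\<^sup>2)"
  let ?y = "\<lambda>u z. u *\<^sub>R x + sqrt (1 - u\<^sup>2) *\<^sub>R z"
  let ?I = "indicator {0..a} :: real \<Rightarrow> real"
  define G1 where "G1 i = (\<lambda>(u, z). ?I u * gauss_dens z * f' i (?y u z))" for i
  define G2 where "G2 i = (\<lambda>(u, z). ?I u * ?q u * (z $ i * gauss_dens z) * f' i (?y u z))" for i
  have i1: "integrable ?M (G1 i)" for i
    using ou_integrand_integrable[OF a(2) weight_indicator gauss_poly.dens f'[of i], of "\<lambda>_. 0" 0 x]
    by (simp add: G1_def)
  have i2: "integrable ?M (G2 i)" for i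
    using ou_integrand_integrable[OF a(2) weight_mult_quotient[OF weight_indicator a(2)] gauss_poly.coord[OF gauss_poly.dens]
      f'[of i], of "\<lambda>_. 0" 0 i x]
    by (simp add: G2_def)
  define G where "G u z = ?I u * gauss_dens z * (\<Sum>i\<in>UNIV. (x - ?q u *\<^sub>R z) $ i * f' i (?y u z))" for u z
  have G_eq: "case_prod G = (\<lambda>p. (\<Sum>i\<in>UNIV. x $ i * G1 i p) - (\<Sum>i\<in>UNIV. G2 i p))"
    unfolding G_def G1_def G2_def sum_distrib_left sum_subtractf[symmetric] fun_eq_iff
    by (auto intro!: sum.cong simp: algebra_simps)
  have Gint: "integrable ?M (case_prod G)" unfolding G_eq using i1 i2 by auto
  have inner: "(\<integral>u. G u z \<partial>lborel) = gauss_dens z * (f (a *\<^sub>R x + sqrt (1 - a\<^sup>2) *\<^sub>R z) - f z)" for z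
  proof -
    let ?h = "\<lambda>u. \<Sum>i\<in>UNIV. (x - ?q u *\<^sub>R z) $ i * f' i (?y u z)"
    have pos: "1 - u\<^sup>2 > 0" if "0 \<le> u" "u \<le> a" for u
      using sqrt_one_minus_bounds(1)[of u a] that a by simp
    have FTC: "(\<integral>u. ?h u * indicator {0..a} u \<partial>lborel) = f (?y a z) - f (?y 0 z)"
    proof (rule integral_FTC_Icc_real[OF a(1)])
      fix u assume u: "0 \<le> u" "u \<le> a"
      note p = pos[OF u]
      have "((\<lambda>u. sqrt (1 - u\<^sup>2)) has_real_derivative - ?q u) (at u)"
        using p by (auto intro!: derivative_eq_intros simp: field_simps)
      from has_vector_derivative_add[OF
          has_vector_derivative_scaleR[OF DERIV_ident has_vector_derivative_const[of x]]
          has_vector_derivative_scaleR[OF this has_vector_derivative_const[of z]]]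
      have v: "((\<lambda>u. ?y u z) has_vector_derivative (x - ?q u *\<^sub>R z)) (at u)" by simp
      show "DERIV (\<lambda>u. f (?y u z)) u :> ?h u"
        by (rule has_real_derivative_along_curve[OF part _ v]) (use f' in \<open>simp add: exp_growth_def\<close>)
      have "isCont (f' i) y" for i y
        using f'[of i] by (simp add: exp_growth_def continuous_on_eq_continuous_at)
      moreover have "isCont (\<lambda>u. ?y u z) u" by (intro continuous_intros)
      ultimately have "isCont (\<lambda>u. f' i (?y u z)) u" for i by (rule isCont_o2[rotated])
      then show "isCont ?h u" using p by (intro continuous_intros) auto
    qed
    have "i * g * h = g * (h * i)" for i g h :: real by simp
    then have "G u z = gauss_dens z * (?h u * indicator {0..a} u)" for u
      unfolding G_def by this
    then have "(\<integral>u. G u z \<partial>lborel) = gauss_dens z * (\<integral>u. ?h u * indicator {0..a} u \<partial>lborel)"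
      by (simp only: integral_mult_right_zero)
    also have "\<dots> = gauss_dens z * (f (a *\<^sub>R x + sqrt (1 - a\<^sup>2) *\<^sub>R z) - f z)"
      unfolding FTC by simp
    finally show ?thesis .
  qed
  have "(\<integral>z. gauss_dens z * (f (a *\<^sub>R x + sqrt (1 - a\<^sup>2) *\<^sub>R z) - f z) \<partial>lborel) = (\<integral>z. (\<integral>u. G u z \<partial>lborel) \<partial>lborel)"
    by (simp add: inner)
  also have "\<dots> = integral\<^sup>L ?M (case_prod G)" by (rule lborel_pair.integral_snd[OF Gint])
  also have "\<dots> = (\<Sum>i\<in>UNIV. x $ i * integral\<^sup>L ?M (G1 i)) - (\<Sum>i\<in>UNIV. integral\<^sup>L ?M (G2 i))"
    unfolding G_eq using i1 i2 by simp
  finally show ?thesis unfolding ou_avg_def G1_def G2_def by simp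
qed

text \<open>Cauchy-Schwarz in linear form: for each r the AM-GM inequality can be integrated
  pointwise, and r = sqrt N is the optimal choice afterwards. For N = 0 that value is excluded, and
  r tends to 0 instead.\<close>

lemma le_sqrt_of_amgm:
  assumes "0 \<le> N" "\<And>r. 0 < r \<Longrightarrow> X \<le> (N / r + r) / 2"
  shows "X \<le> sqrt N"
proof (cases "N = 0")
  case True
  have "X \<le> 0 + e" if "0 < e" for e using assms(2)[of "2 * e"] that True by simp
  then show ?thesis using field_le_epsilon[of X 0] by (simp add: True)
next
  case False
  then show ?thesis using assms(1) assms(2)[of "sqrt N"] by (simp add: real_div_sqrt)
qed

text \<open>The index \<open>i # j # js\<close> of \<open>D\<^sup>kF\<close> is matched with \<open>J = js @ [i]\<close>, the index of the derivative of f that it contains.\<close>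
lemma sum_lists_Suc_Suc:
  fixes h :: "'n::finite list \<Rightarrow> real"
  assumes "k \<ge> 1"
  shows "(\<Sum>is\<in>{is. length is = k + 1}. h is)
    = (\<Sum>J\<in>{J. length J = k}. \<Sum>j\<in>UNIV. h (last J # j # butlast J))"
proof -
  have ne: "length J = k \<Longrightarrow> J \<noteq> []" for J :: "'n list" using assms by auto
  have "(\<Sum>(J, j)\<in>{J. length J = k} \<times> UNIV. h (last J # j # butlast J)) = (\<Sum>is\<in>{is. length is = k + 1}. h is)"
  proof (rule sum.reindex_bij_witness[where i = "\<lambda>is. (tl (tl is) @ [hd is], hd (tl is))"
        and j = "\<lambda>(J, j). last J # j # butlast J"])
    fix L :: "'n list" assume "L \<in> {is. length is = k + 1}"
    then have l: "length L = k + 1" by simp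
    \<comment> \<open>Since k >= 1, the list has at least two entries to split off.\<close>
    then obtain i j js where "L = i # j # js" using assms by (cases L; cases "tl L") auto
    then show "(case (tl (tl L) @ [hd L], hd (tl L)) of (J, j) \<Rightarrow> last J # j # butlast J) = L"
      "(tl (tl L) @ [hd L], hd (tl L)) \<in> {J. length J = k} \<times> UNIV"
      using l by auto
  qed (use assms ne in auto)
  then show ?thesis by (simp add: sum.cartesian_product)
qed

text \<open>The Gaussian linear form with coefficients \<open>B J\<close> has the sum of their
  squares as second moment, the vector of all T_J has length at most 1, and W has mass at most 1.
  Cauchy-Schwarz over J, u and z combines the three.\<close>

lemma ou_pairing_bound:
  fixes T :: "'b \<Rightarrow> real^'n::finite \<Rightarrow> real" and B :: "'b \<Rightarrow> 'n \<Rightarrow> real"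
  assumes a: "0 \<le> a" "a < 1" and S: "finite S"
    and T: "\<And>J. J \<in> S \<Longrightarrow> exp_growth (T J)" "\<And>y. (\<Sum>J\<in>S. (T J y)\<^sup>2) \<le> 1"
    and mass: "(\<integral>z. gauss_dens (z :: real^'n) \<partial>lborel) = 1"
    and W: "W = (\<lambda>u. indicator {0..a} u * u ^ n * (u / sqrt (1 - u\<^sup>2)))"
  shows "(\<Sum>J\<in>S. \<Sum>j\<in>UNIV. B J j * ou_avg W (\<lambda>z. z $ j * gauss_dens z) (T J) x)
    \<le> sqrt (\<Sum>J\<in>S. \<Sum>j\<in>UNIV. (B J j)\<^sup>2)"
proof (rule le_sqrt_of_amgm)
  let ?M = "lborel \<Otimes>\<^sub>M lborel :: (real \<times> (real^'n)) measure"
  let ?y = "\<lambda>u z. u *\<^sub>R x + sqrt (1 - u\<^sup>2) *\<^sub>R z"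
  let ?N = "\<Sum>J\<in>S. \<Sum>j\<in>UNIV. (B J j)\<^sup>2"
  define Y where "Y J z = (\<Sum>j\<in>UNIV. B J j * z $ j)" for J and z :: "real^'n"
  show "0 \<le> ?N" by (intro sum_nonneg) auto
  fix r :: real assume r: "0 < r"
  have Wn: "weight a W"
    using weight_mult_quotient[OF weight_indicator_power a(2)] a(2) by (simp add: W)
  have W0: "0 \<le> W u" for u
    unfolding W using sqrt_one_minus_bounds(1)[of u a] a by (cases "u \<in> {0..a}") auto
  have Wint: "integrable lborel W"
  proof -
    obtain C where C: "\<And>u. \<bar>W u\<bar> \<le> C * indicator {0..a} u" using Wn by (auto simp: weight_def)
    show ?thesis
    proof (rule Bochner_Integration.integrable_bound)
      show "integrable lborel (\<lambda>u::real. C * indicator {0..a} u)" 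
        by (auto simp: emeasure_lborel_Icc_eq intro!: integrable_real_indicator)
      show "AE u in lborel. norm (W u) \<le> norm (C * indicator {0..a} u)"
        using C by (intro AE_I2) (metis abs_ge_self order_trans real_norm_def)
    qed (use Wn in \<open>auto simp: weight_def\<close>)
  qed
  \<comment> \<open>The AM-GM majorant after T has been removed through the bound on the sum of the
    T_J^2: it depends on neither u nor x.\<close>
  define R where "R z = (1 / (2 * r)) * (\<Sum>J\<in>S. (Y J z)\<^sup>2 * gauss_dens z) + (r / 2) * gauss_dens z" for z
  have Rgp: "gauss_poly R"
    unfolding R_def Y_def by (intro gauss_poly.lincomb gauss_poly.dens gauss_poly_sum S gauss_integral_linear_form_sq)
  have Rint: "(\<integral>z. R z \<partial>lborel) = (?N / r + r) / 2"
  proof -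
    have gi: "integrable lborel (\<lambda>z. (Y J z)\<^sup>2 * gauss_dens z)" for J
      unfolding Y_def by (intro gauss_poly_integrable' gauss_integral_linear_form_sq)
    have "(\<integral>z. R z \<partial>lborel) = (1 / (2 * r)) * (\<Sum>J\<in>S. \<integral>z. (Y J z)\<^sup>2 * gauss_dens z \<partial>lborel)
        + (r / 2) * (\<integral>z. gauss_dens (z::real^'n) \<partial>lborel)"
      unfolding R_def
      by (subst Bochner_Integration.integral_add)
        (use gi gauss_poly_integrable'[OF gauss_poly.dens, where 'a = 'n] in \<open>auto simp: Bochner_Integration.integral_sum\<close>)
    also have "\<dots> = (?N / r + r) / 2"
      unfolding Y_def gauss_integral_linear_form_sq mass by (simp add: field_simps)
    finally show ?thesis .
  qed
  have P: "integrable ?M (\<lambda>(u, z). W u * R z)"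
    using ou_integrand_integrable[OF a(2) Wn Rgp exp_growth_const[of 1], of "\<lambda>_. 0" 0] by simp
  define G where "G J j = (\<lambda>(u, z). W u * (z $ j * gauss_dens z) * T J (?y u z))" for J j
  have Gi: "integrable ?M (G J j)" if "J \<in> S" for J j
    unfolding G_def
    using ou_integrand_integrable[OF a(2) Wn gauss_poly.coord[OF gauss_poly.dens] T(1)[OF that], of "\<lambda>_. 0" 0] by simp
  have "(\<Sum>J\<in>S. \<Sum>j\<in>UNIV. B J j * ou_avg W (\<lambda>z. z $ j * gauss_dens z) (T J) x)
     = (\<Sum>J\<in>S. \<Sum>j\<in>UNIV. B J j * integral\<^sup>L ?M (G J j))"
    by (simp add: ou_avg_def G_def)
  also have "\<dots> = (\<integral>p. (\<Sum>J\<in>S. \<Sum>j\<in>UNIV. B J j * G J j p) \<partial>?M)"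
    using Gi by (simp add: Bochner_Integration.integral_sum Bochner_Integration.integrable_sum)
  also have "\<dots> \<le> (\<integral>p. (case p of (u, z) \<Rightarrow> W u * R z) \<partial>?M)"
  proof (rule integral_mono[OF _ P])
    show "integrable ?M (\<lambda>p. \<Sum>J\<in>S. \<Sum>j\<in>UNIV. B J j * G J j p)" using Gi by auto
    fix p :: "real \<times> (real^'n)"
    obtain u z where p: "p = (u, z)" by (cases p)
    have "T J (?y u z) * Y J z \<le> (1 / (2 * r)) * (Y J z)\<^sup>2 + (r / 2) * (T J (?y u z))\<^sup>2" for J
    proof -
      have "0 \<le> (Y J z - r * T J (?y u z))\<^sup>2" by simp
      then have "2 * r * (T J (?y u z) * Y J z) \<le> (Y J z)\<^sup>2 + r\<^sup>2 * (T J (?y u z))\<^sup>2"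
        by (simp add: power2_eq_square algebra_simps)
      with r show ?thesis by (simp add: field_simps power2_eq_square)
    qed
    then have "(\<Sum>J\<in>S. T J (?y u z) * Y J z)
        \<le> (\<Sum>J\<in>S. (1 / (2 * r)) * (Y J z)\<^sup>2 + (r / 2) * (T J (?y u z))\<^sup>2)" by (rule sum_mono)
    also have "\<dots> = (1 / (2 * r)) * (\<Sum>J\<in>S. (Y J z)\<^sup>2) + (r / 2) * (\<Sum>J\<in>S. (T J (?y u z))\<^sup>2)"
      by (simp add: sum.distrib sum_distrib_left)
    also have "\<dots> \<le> (1 / (2 * r)) * (\<Sum>J\<in>S. (Y J z)\<^sup>2) + (r / 2) * 1"
      using T(2) r by (intro add_left_mono mult_left_mono) auto
    finally have "W u * (gauss_dens z * (\<Sum>J\<in>S. T J (?y u z) * Y J z))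
        \<le> W u * (gauss_dens z * ((1 / (2 * r)) * (\<Sum>J\<in>S. (Y J z)\<^sup>2) + (r / 2) * 1))"
      by (intro mult_left_mono W0 gauss_dens_nonneg)
    also have "\<dots> = W u * R z" by (simp add: R_def sum_distrib_left sum_distrib_right algebra_simps)
    finally show "(\<Sum>J\<in>S. \<Sum>j\<in>UNIV. B J j * G J j p) \<le> (case p of (u, z) \<Rightarrow> W u * R z)"
      by (simp add: p G_def Y_def sum_distrib_left sum_distrib_right mult_ac)
  qed
  also have "\<dots> = (\<integral>u. (\<integral>z. W u * R z \<partial>lborel) \<partial>lborel)"
    using lborel_pair.integral_fst'[OF P] by simp
  also have "\<dots> = (\<integral>u. W u \<partial>lborel) * ((?N / r + r) / 2)" by (simp add: Rint)
  also have "\<dots> \<le> 1 * ((?N / r + r) / 2)"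
    using integral_ou_quotient_le[OF a, of n] r \<open>0 \<le> ?N\<close>
    unfolding W by (intro mult_right_mono) auto
  finally show "(\<Sum>J\<in>S. \<Sum>j\<in>UNIV. B J j * ou_avg W (\<lambda>z. z $ j * gauss_dens z) (T J) x) \<le> (?N / r + r) / 2"
    by simp
qed

section \<open>The Stein equation on the vector field\<close>

lemma poly_fun_deg_coord_power:
  assumes "n \<le> m"
  shows "poly_fun_deg m (\<lambda>x::real^'n::finite. (x $ i) ^ n)"
proof -
  have "(\<Prod>j\<in>UNIV. (x $ j) ^ (if j = i then n else 0)) = (x $ i) ^ n" for x :: "real^'n"
    by (simp add: if_distrib[of "power _"] cong: if_cong)
  then show ?thesis
    unfolding poly_fun_deg_def using assms
    by (intro exI[of _ "{\<lambda>j. if j = i then n else 0}"] exI[of _ "\<lambda>_. 1"]) simp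
qed

lemma gauss_measure_eq: "gauss_measure = density lborel (\<lambda>x. ennreal (gauss_dens x))"
  by (simp add: gauss_measure_def gauss_dens_def)

lemma integral_gauss_measure:
  fixes f :: "real^'n::finite \<Rightarrow> real"
  assumes "f \<in> borel_measurable borel"
  shows "(\<integral>x. f x \<partial>gauss_measure) = (\<integral>x. gauss_dens x * f x \<partial>lborel)"
proof -
  have "(gauss_dens :: real^'n \<Rightarrow> real) \<in> borel_measurable borel"
    by (intro borel_measurable_continuous_onI gauss_poly_continuous gauss_poly.dens)
  then show ?thesis
    unfolding gauss_measure_eq using assms by (subst integral_density) (auto simp: gauss_dens_nonneg)
qed

text \<open>Matching the constant polynomial 1 transfers the total mass of the probability measure
  to the Gaussian density.\<close>

lemma gauss_mass_of_moments_match: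
  fixes \<mu> :: "(real^'n::finite) measure"
  assumes "moments_match m \<mu>" "prob_space \<mu>"
  shows "(\<integral>z. gauss_dens (z :: real^'n) \<partial>lborel) = 1"
proof -
  interpret prob_space \<mu> by fact
  have "poly_fun_deg m (\<lambda>x::real^'n. 1)" using poly_fun_deg_coord_power[of 0 m] by simp
  then have "(\<integral>x. 1 \<partial>\<mu>) = (\<integral>x. (1::real) \<partial>(gauss_measure :: (real^'n) measure))"
    using assms(1) unfolding moments_match_def by metis
  then show ?thesis using integral_gauss_measure[of "\<lambda>_::real^'n. 1"] by (simp add: prob_space)
qed

text \<open>Pure powers of single coordinates are enough, because |x| is comparable with its largest
  coordinate. Odd k does no harm, as integrability passes to absolute values.\<close>

lemma integrable_one_plus_norm_power:
  fixes \<mu> :: "(real^'n::finite) measure"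
  assumes "moments_match m \<mu>" "prob_space \<mu>" "sets \<mu> = sets borel" "k \<le> m"
  shows "integrable \<mu> (\<lambda>x. (1 + norm x) ^ k)"
proof -
  interpret prob_space \<mu> by fact
  note [measurable_cong] = assms(3)
  let ?c = "real (Suc CARD('n))"
  have "integrable \<mu> (\<lambda>x. (x $ i) ^ k)" for i
    using assms(1) poly_fun_deg_coord_power[OF assms(4)] by (auto simp: moments_match_def)
  then have int: "integrable \<mu> (\<lambda>x. ?c ^ k * (1 + (\<Sum>i\<in>UNIV. \<bar>(x $ i) ^ k\<bar>)))" by auto
  have bound: "(1 + norm x) ^ k \<le> ?c ^ k * (1 + (\<Sum>i\<in>UNIV. \<bar>(x $ i) ^ k\<bar>))" for x :: "real^'n"
  proof -
    \<comment> \<open>With 1 included in the maximum, 1 + |x| <= (d + 1) b for d =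
      \<open>CARD('n)\<close>, and b is either 1 or some |x_i|, so b^k is one of the summands of the
      bound.\<close>
    define b where "b = Max (insert 1 (range (\<lambda>i. \<bar>x $ i\<bar>)))"
    have b: "1 \<le> b" "\<bar>x $ i\<bar> \<le> b" for i
      unfolding b_def by (rule Max_ge; simp)+
    have "b \<in> insert 1 (range (\<lambda>i. \<bar>x $ i\<bar>))" unfolding b_def by (intro Max_in) auto
    then have bk: "b ^ k \<le> 1 + (\<Sum>i\<in>UNIV. \<bar>(x $ i) ^ k\<bar>)"
    proof
      assume "b \<in> range (\<lambda>i. \<bar>x $ i\<bar>)"
      then obtain i where "b = \<bar>x $ i\<bar>" by blast
      moreover have "\<bar>(x $ i) ^ k\<bar> \<le> (\<Sum>i\<in>UNIV. \<bar>(x $ i) ^ k\<bar>)" by (rule member_le_sum) auto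
      ultimately show ?thesis by (simp add: power_abs)
    qed (simp add: sum_nonneg)
    have "1 + norm x \<le> 1 + (\<Sum>i\<in>UNIV. \<bar>x $ i\<bar>)" using norm_le_l1_cart by simp
    also have "\<dots> \<le> b + (\<Sum>i\<in>(UNIV::'n set). b)" using b by (intro add_mono sum_mono) auto
    also have "\<dots> = ?c * b" by (simp add: algebra_simps)
    finally have "(1 + norm x) ^ k \<le> (?c * b) ^ k" by (intro power_mono) auto
    also have "\<dots> \<le> ?c ^ k * (1 + (\<Sum>i\<in>UNIV. \<bar>(x $ i) ^ k\<bar>))"
      unfolding power_mult_distrib using bk by (intro mult_left_mono) auto
    finally show ?thesis .
  qed
  show ?thesis
  proof (rule Bochner_Integration.integrable_bound[OF int])
    show "AE x in \<mu>. norm ((1 + norm x) ^ k) \<le> norm (?c ^ k * (1 + (\<Sum>i\<in>UNIV. \<bar>(x $ i) ^ k\<bar>)))"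
    proof (rule AE_I2)
      fix x :: "real^'n"
      have "0 \<le> ?c ^ k * (1 + (\<Sum>i\<in>UNIV. \<bar>(x $ i) ^ k\<bar>))"
        by (intro mult_nonneg_nonneg add_nonneg_nonneg sum_nonneg) auto
      with bound[of x] show "norm ((1 + norm x) ^ k) \<le> norm (?c ^ k * (1 + (\<Sum>i\<in>UNIV. \<bar>(x $ i) ^ k\<bar>)))"
        by simp
    qed
  qed measurable
qed

section \<open>The test field, its Stein operator and its derivatives\<close>

definition ou_field :: "real \<Rightarrow> (real^'n::finite \<Rightarrow> real) \<Rightarrow> real^'n \<Rightarrow> real^'n" where
  "ou_field a f x = (\<chi> i. ou_avg (indicator {0..a}) gauss_dens (pd [i] f) x)"

lemma ou_field_component: "(\<lambda>x. ou_field a f x $ i) = ou_avg (indicator {0..a}) gauss_dens (pd [i] f)"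
  by (simp add: ou_field_def)

context
  fixes k :: nat and f :: "real^'n::finite \<Rightarrow> real" and a :: real
  assumes k: "k \<ge> 1" and f: "Ck k f" "\<And>x. tnorm k (Dk_scalar k f x) \<le> 1"
    and a: "0 \<le> a" "a < 1"
begin

lemma exp_growth_pd: "length js \<le> k \<Longrightarrow> exp_growth (pd js f)"
  using pd_poly_growth[OF f, of js "k - length js"] poly_growth_imp_exp_growth by simp

text \<open>\<open>stein_kernel\<close> admits smooth test fields only; the cut-off a < 1 provides
  this although f is just C^k.\<close>

lemma smooth_ou_field: "smooth_vf (ou_field a f)"
  unfolding smooth_vf_def ou_field_component
  using Ck_ou_avg[OF a(2) weight_indicator gauss_poly.dens exp_growth_pd[of "[_]"]] k by simp

lemma stein_operator_ou_field:
  "x \<bullet> ou_field a f x - divergence (ou_field a f) x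
    = (\<integral>z. gauss_dens z * (f (a *\<^sub>R x + sqrt (1 - a\<^sup>2) *\<^sub>R z) - f z) \<partial>lborel)"
proof -
  have "partial i (ou_avg (indicator {0..a}) gauss_dens (pd [i] f))
      = ou_avg (\<lambda>u. indicator {0..a} u * (u / sqrt (1 - u\<^sup>2))) (\<lambda>z. z $ i * gauss_dens z) (pd [i] f)" for i
    using partial_eq[OF has_partial_ou_avg[OF a(2) weight_indicator gauss_poly.dens exp_growth_pd[of "[i]"]
          gauss_poly_uminus[OF gauss_poly.coord[OF gauss_poly.dens]] has_partial_gauss_dens]] k
    by simp
  moreover have "x \<bullet> ou_field a f x = (\<Sum>i\<in>UNIV. x $ i * ou_avg (indicator {0..a}) gauss_dens (pd [i] f) x)"
    by (simp add: inner_vec_def ou_field_def)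
  ultimately show ?thesis
    using ou_avg_generator[OF a, of f "\<lambda>i. pd [i] f" x] Ck_has_partial[OF f(1), of "[]"]
      exp_growth_pd[of "[]"] exp_growth_pd[of "[_]"] k
    by (simp add: divergence_def ou_field_component)
qed

text \<open>The strict bound on the length leaves room for i: the component already contains one
  derivative of f, so at most k - 1 more can be moved onto it, each bringing a factor u.\<close>

lemma pd_ou_avg:
  "length js < k \<Longrightarrow> pd js (ou_avg (indicator {0..a}) gauss_dens (pd [i] f))
     = ou_avg (\<lambda>u. indicator {0..a} u * u ^ length js) gauss_dens (pd (js @ [i]) f)"
proof (induction js)
  case (Cons j js)
  have "has_partial j (ou_avg (\<lambda>u. indicator {0..a} u * u ^ length js) gauss_dens (pd (js @ [i]) f))
     (ou_avg (\<lambda>u. indicator {0..a} u * u ^ length js * u) gauss_dens (pd (j # js @ [i]) f))"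
    using Cons.prems
    by (intro has_partial_ou_avg'[OF a(2)] weight_indicator_power[OF a(2)] gauss_poly.dens exp_growth_pd
        Ck_has_partial[OF f(1)]) auto
  from partial_eq[OF this] Cons show ?case by (simp add: mult_ac)
qed simp

text \<open>\<open>pd J f\<close> spends all k derivatives of f, so the outermost one, j, has to
  fall on the density.\<close>

lemma Dk_vf_ou_field:
  assumes "length J = k"
  shows "Dk_vf k (ou_field a f) x (last J # j # butlast J)
    = ou_avg (\<lambda>u. indicator {0..a} u * u ^ (k - 1) * (u / sqrt (1 - u\<^sup>2)))
        (\<lambda>z. z $ j * gauss_dens z) (pd J f) x"
proof -
  have J: "butlast J @ [last J] = J" using assms k by (intro append_butlast_last_id) auto
  \<comment> \<open>One sign comes from differentiating the density, the other from the compensating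
    shift of z.\<close>
  have "has_partial j (ou_avg (\<lambda>u. indicator {0..a} u * u ^ (k - 1)) gauss_dens (pd J f))
     (ou_avg (\<lambda>u. indicator {0..a} u * u ^ (k - 1) * (u / sqrt (1 - u\<^sup>2))) (\<lambda>z. - (- (z $ j * gauss_dens z))) (pd J f))"
    using assms
    by (intro has_partial_ou_avg[OF a(2)] weight_indicator_power[OF a(2)] gauss_poly.intros gauss_poly_uminus
        exp_growth_pd has_partial_gauss_dens) auto
  from partial_eq[OF this] show ?thesis
    using pd_ou_avg[of "butlast J" "last J"] assms k by (simp add: Dk_vf_def ou_field_component J)
qed

lemma tinner_ou_field_le:
  assumes mass: "(\<integral>z. gauss_dens (z :: real^'n) \<partial>lborel) = 1"
  shows "tinner (k + 1) A (Dk_vf k (ou_field a f) x) \<le> tnorm (k + 1) A"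
proof -
  have "tinner (k + 1) A (Dk_vf k (ou_field a f) x)
    = (\<Sum>J\<in>{J. length J = k}. \<Sum>j\<in>UNIV. A (last J # j # butlast J) *
        ou_avg (\<lambda>u. indicator {0..a} u * u ^ (k - 1) * (u / sqrt (1 - u\<^sup>2))) (\<lambda>z. z $ j * gauss_dens z) (pd J f) x)"
    unfolding tinner_def sum_lists_Suc_Suc[OF k] by (intro sum.cong refl) (simp add: Dk_vf_ou_field)
  also have "\<dots> \<le> sqrt (\<Sum>J\<in>{J. length J = k}. \<Sum>j\<in>UNIV. (A (last J # j # butlast J))\<^sup>2)"
  proof (rule ou_pairing_bound[OF a _ _ _ mass refl])
    fix y
    have "(tnorm k (Dk_scalar k f y))\<^sup>2 \<le> 1\<^sup>2" using f(2) by (intro power_mono) auto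
    then show "(\<Sum>J\<in>{J. length J = k}. (pd J f y)\<^sup>2) \<le> 1" by (simp add: tnorm_sq Dk_scalar_def)
  qed (use exp_growth_pd in auto)
  also have "\<dots> = tnorm (k + 1) A"
    using sum_lists_Suc_Suc[OF k, of "\<lambda>L. (A L)\<^sup>2"] by (simp add: tnorm_def tinner_def power2_eq_square)
  finally show ?thesis .
qed

text \<open>The pairing bound with A equal to the tensor itself reads t^2 <= t. This gives the
  square integrability of D^k F that a Stein kernel asks of its test fields.\<close>

lemma tnorm_ou_field_le:
  assumes mass: "(\<integral>z. gauss_dens (z :: real^'n) \<partial>lborel) = 1"
  shows "tnorm (k + 1) (Dk_vf k (ou_field a f) x) \<le> 1"
proof -
  let ?t = "tnorm (k + 1) (Dk_vf k (ou_field a f) x)"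
  have "?t\<^sup>2 \<le> ?t"
    using tinner_ou_field_le[OF mass, of "Dk_vf k (ou_field a f) x" x]
    by (subst tnorm_sq) (simp only: tinner_def power2_eq_square)
  show ?thesis
  proof (rule ccontr)
    assume "\<not> ?thesis"
    then have "?t * 1 < ?t * ?t" by (intro mult_strict_left_mono) auto
    with \<open>?t\<^sup>2 \<le> ?t\<close> show False by (simp add: power2_eq_square)
  qed
qed

end

section \<open>Testing a kernel against the field, and the limit in a\<close>

lemma integral_tnorm_le:
  fixes \<tau> :: "'a \<Rightarrow> 'n::finite tensor"
  assumes "prob_space \<mu>" and meas: "\<And>is. (\<lambda>x. \<tau> x is) \<in> borel_measurable \<mu>"
    and fin: "(\<integral>\<^sup>+ x. ennreal ((tnorm m (\<tau> x))\<^sup>2) \<partial>\<mu>) < \<top>"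
  shows "integrable \<mu> (\<lambda>x. tnorm m (\<tau> x))"
    and "(\<integral>x. tnorm m (\<tau> x) \<partial>\<mu>) \<le> sqrt (enn2real (\<integral>\<^sup>+ x. ennreal ((tnorm m (\<tau> x))\<^sup>2) \<partial>\<mu>))"
proof -
  interpret prob_space \<mu> by fact
  have [measurable]: "(\<lambda>x. tnorm m (\<tau> x)) \<in> borel_measurable \<mu>"
    unfolding tnorm_def tinner_def using meas by measurable
  have i2: "integrable \<mu> (\<lambda>x. (tnorm m (\<tau> x))\<^sup>2)"
    using fin by (intro integrableI_bounded) auto
  \<comment> \<open>The choice r = 1 gives integrability of the norm from that of its square; all r
    > 0 together give Cauchy-Schwarz on a probability space.\<close>
  have pt: "tnorm m (\<tau> x) \<le> ((tnorm m (\<tau> x))\<^sup>2 / r + r) / 2" if "0 < r" for x r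
    using that sum_squares_bound[of "tnorm m (\<tau> x)" r] by (simp add: field_simps power2_eq_square)
  show i: "integrable \<mu> (\<lambda>x. tnorm m (\<tau> x))"
  proof (rule Bochner_Integration.integrable_bound)
    show "integrable \<mu> (\<lambda>x. ((tnorm m (\<tau> x))\<^sup>2 / 1 + 1) / 2)" using i2 by simp
    show "AE x in \<mu>. norm (tnorm m (\<tau> x)) \<le> norm (((tnorm m (\<tau> x))\<^sup>2 / 1 + 1) / 2)"
    proof (rule AE_I2)
      fix x
      show "norm (tnorm m (\<tau> x)) \<le> norm (((tnorm m (\<tau> x))\<^sup>2 / 1 + 1) / 2)"
        using pt[of 1 x] by (simp add: abs_of_nonneg)
    qed
  qed measurable
  have N: "enn2real (\<integral>\<^sup>+ x. ennreal ((tnorm m (\<tau> x))\<^sup>2) \<partial>\<mu>) = (\<integral>x. (tnorm m (\<tau> x))\<^sup>2 \<partial>\<mu>)"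
    by (subst nn_integral_eq_integral[OF i2]) (auto simp: enn2real_ennreal)
  show "(\<integral>x. tnorm m (\<tau> x) \<partial>\<mu>) \<le> sqrt (enn2real (\<integral>\<^sup>+ x. ennreal ((tnorm m (\<tau> x))\<^sup>2) \<partial>\<mu>))"
    unfolding N
  proof (rule le_sqrt_of_amgm)
    fix r :: real assume r: "0 < r"
    have "(\<integral>x. tnorm m (\<tau> x) \<partial>\<mu>) \<le> (\<integral>x. ((tnorm m (\<tau> x))\<^sup>2 / r + r) / 2 \<partial>\<mu>)"
      using i i2 pt[OF r] by (intro integral_mono) auto
    also have "\<dots> = ((\<integral>x. (tnorm m (\<tau> x))\<^sup>2 \<partial>\<mu>) / r + r) / 2" using i2 by (simp add: prob_space)
    finally show "(\<integral>x. tnorm m (\<tau> x) \<partial>\<mu>) \<le> ((\<integral>x. (tnorm m (\<tau> x))\<^sup>2 \<partial>\<mu>) / r + r) / 2" .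
  qed simp
qed

lemma integral_ou_field_le:
  fixes \<mu> :: "(real^'n::finite) measure"
  assumes k: "k \<ge> 1" and \<mu>: "prob_space \<mu>" "sets \<mu> = sets borel"
    and f: "Ck k f" "\<And>x. tnorm k (Dk_scalar k f x) \<le> 1" and a: "0 \<le> a" "a < 1"
    and mass: "(\<integral>z. gauss_dens (z :: real^'n) \<partial>lborel) = 1"
    and \<tau>: "stein_kernel k \<mu> \<tau>" and fin: "(\<integral>\<^sup>+ x. ennreal ((tnorm (k + 1) (\<tau> x))\<^sup>2) \<partial>\<mu>) < \<top>"
    and int: "integrable \<mu> (\<lambda>x. x \<bullet> ou_field a f x - divergence (ou_field a f) x)"
  shows "(\<integral>x. x \<bullet> ou_field a f x - divergence (ou_field a f) x \<partial>\<mu>)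
    \<le> sqrt (enn2real (\<integral>\<^sup>+ x. ennreal ((tnorm (k + 1) (\<tau> x))\<^sup>2) \<partial>\<mu>))"
proof -
  interpret prob_space \<mu> by (fact \<mu>(1))
  let ?F = "ou_field a f"
  have \<tau>_meas: "(\<lambda>x. \<tau> x is) \<in> borel_measurable \<mu>" for "is"
    using \<tau> unfolding stein_kernel_def by blast
  have smooth: "smooth_vf ?F" by (rule smooth_ou_field[OF k f a])
  have "(\<lambda>x. Dk_vf k ?F x L) \<in> borel_measurable \<mu>" for L
  proof (cases L)
    case (Cons i js)
    have "continuous_on UNIV (pd js (\<lambda>y. ?F y $ i))"
      using smooth unfolding smooth_vf_def Ck_def by blast
    then have "pd js (\<lambda>y. ?F y $ i) \<in> borel_measurable borel" by (rule borel_measurable_continuous_onI)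
    then show ?thesis by (simp add: Dk_vf_def Cons measurable_cong_sets[OF \<mu>(2) refl])
  qed (simp add: Dk_vf_def)
  then have [measurable]: "(\<lambda>x. (tnorm (k + 1) (Dk_vf k ?F x))\<^sup>2) \<in> borel_measurable \<mu>"
    unfolding tnorm_sq by measurable
  have "integrable \<mu> (\<lambda>x. (tnorm (k + 1) (Dk_vf k ?F x))\<^sup>2)"
  proof (rule integrable_const_bound[where B = 1])
    show "AE x in \<mu>. norm ((tnorm (k + 1) (Dk_vf k ?F x))\<^sup>2) \<le> 1"
      using tnorm_ou_field_le[OF k f a mass] by (intro AE_I2) (simp add: power_le_one)
  qed measurable
  then have "(\<integral>x. x \<bullet> ?F x - divergence ?F x \<partial>\<mu>) = (\<integral>x. tinner (k + 1) (\<tau> x) (Dk_vf k ?F x) \<partial>\<mu>)"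
    by (rule \<tau>[unfolded stein_kernel_def, THEN conjunct2, THEN conjunct2, rule_format, OF smooth int, symmetric])
  \<comment> \<open>\<open>integral_mono'\<close> asks for integrability of the nonnegative majorant
    only: a pairing that is not integrable would have the default integral 0.\<close>
  also have "\<dots> \<le> (\<integral>x. tnorm (k + 1) (\<tau> x) \<partial>\<mu>)"
    by (intro integral_mono' integral_tnorm_le(1)[OF \<mu>(1) \<tau>_meas fin] tinner_ou_field_le[OF k f a mass]) simp
  also have "\<dots> \<le> sqrt (enn2real (\<integral>\<^sup>+ x. ennreal ((tnorm (k + 1) (\<tau> x))\<^sup>2) \<partial>\<mu>))"
    by (rule integral_tnorm_le(2)[OF \<mu>(1) \<tau>_meas fin])
  finally show ?thesis .
qed

text \<open>For a < 1 the Stein identity bounds the difference between the average of Q_a f under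
  the measure and the Gaussian average of f, by a quantity free of a. As a tends to 1, Q_a f tends
  to f pointwise by continuity of f, and growth of degree k, integrable by the moments, permits the
  limit under the measure.\<close>

lemma integral_diff_gauss_le:
  fixes \<mu> :: "(real^'n::finite) measure"
  assumes k: "k \<ge> 1" and \<mu>: "prob_space \<mu>" "sets \<mu> = sets borel" "moments_match (k + 1) \<mu>"
    and f: "Ck k f" "\<And>x. tnorm k (Dk_scalar k f x) \<le> 1"
    and \<tau>: "stein_kernel k \<mu> \<tau>" and fin: "(\<integral>\<^sup>+ x. ennreal ((tnorm (k + 1) (\<tau> x))\<^sup>2) \<partial>\<mu>) < \<top>"
  shows "(\<integral>x. f x \<partial>\<mu>) - (\<integral>x. f x \<partial>gauss_measure)
    \<le> sqrt (enn2real (\<integral>\<^sup>+ x. ennreal ((tnorm (k + 1) (\<tau> x))\<^sup>2) \<partial>\<mu>))" (is "_ \<le> ?R")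
proof -
  interpret prob_space \<mu> by (fact \<mu>(1))
  note [measurable_cong] = \<mu>(2)
  note mass = gauss_mass_of_moments_match[OF \<mu>(3,1)]
  have pg: "poly_growth k f" using pd_poly_growth[OF f, of "[]" k] by simp
  then have fc: "continuous_on UNIV f" by (simp add: poly_growth_def)
  obtain C where C: "\<And>y. \<bar>f y\<bar> \<le> C * (1 + norm y) ^ k" using pg by (auto simp: poly_growth_def)
  have C0: "0 \<le> C" using C[of 0] by simp
  have [measurable]: "f \<in> borel_measurable borel" "(gauss_dens :: real^'n \<Rightarrow> real) \<in> borel_measurable borel"
    using fc by (auto intro!: borel_measurable_continuous_onI gauss_poly_continuous gauss_poly.dens)
  define Q where "Q a x = (\<integral>z. gauss_dens z * f (a *\<^sub>R x + sqrt (1 - a\<^sup>2) *\<^sub>R z) \<partial>lborel)" for a x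
  \<comment> \<open>Since 1 + |x| + |z| <= (1 + |x|) (1 + |z|), the growth bound splits into a
    function of x and one of z. Hence \<open>D x\<close> majorises the integrand for all a in [0,
    1), and integrating it leaves K (1 + |x|)^k.\<close>
  define D where "D x z = (C * (1 + norm x) ^ k) * (gauss_dens z * (1 + norm z) ^ k)" for x z :: "real^'n"
  define K where "K = C * (\<integral>z. gauss_dens z * (1 + norm (z :: real^'n)) ^ k \<partial>lborel)"
  have Dint: "integrable lborel (D x)" for x
    unfolding D_def by (intro integrable_mult_right gauss_poly_integrable gauss_poly.dens exp_growth_one_plus_norm_power)
  have bd: "\<bar>gauss_dens z * f (a *\<^sub>R x + sqrt (1 - a\<^sup>2) *\<^sub>R z)\<bar> \<le> D x z" if a: "0 \<le> a" "a < 1" for a x z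
  proof -
    have s: "0 \<le> sqrt (1 - a\<^sup>2)" "sqrt (1 - a\<^sup>2) \<le> 1" using sqrt_one_minus_bounds[of a a] a by auto
    have "norm (a *\<^sub>R x + sqrt (1 - a\<^sup>2) *\<^sub>R z) \<le> a * norm x + sqrt (1 - a\<^sup>2) * norm z"
      using a s by (intro norm_triangle_le) simp
    also have "\<dots> \<le> norm x + norm z" using a s by (intro add_mono mult_left_le_one_le) auto
    also have "1 + \<dots> \<le> (1 + norm x) * (1 + norm z)" by (simp add: algebra_simps)
    finally have "(1 + norm (a *\<^sub>R x + sqrt (1 - a\<^sup>2) *\<^sub>R z)) ^ k \<le> ((1 + norm x) * (1 + norm z)) ^ k"
      by (intro power_mono) auto
    from mult_left_mono[OF this C0] C
    have "\<bar>f (a *\<^sub>R x + sqrt (1 - a\<^sup>2) *\<^sub>R z)\<bar> \<le> C * ((1 + norm x) ^ k * (1 + norm z) ^ k)"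
      unfolding power_mult_distrib by (rule order_trans[rotated])
    from mult_left_mono[OF this gauss_dens_nonneg] show ?thesis
      by (simp add: D_def abs_mult gauss_dens_nonneg mult_ac)
  qed
  have Qint: "integrable lborel (\<lambda>z. gauss_dens z * f (a *\<^sub>R x + sqrt (1 - a\<^sup>2) *\<^sub>R z))" if "0 \<le> a" "a < 1" for a x
    by (rule Bochner_Integration.integrable_bound[OF Dint[of x]]) (use order_trans[OF bd[OF that] abs_ge_self] in auto)
  have Qm [measurable]: "Q a \<in> borel_measurable \<mu>" for a
    unfolding Q_def by measurable
  have Qbd: "\<bar>Q a x\<bar> \<le> K * (1 + norm x) ^ k" if "0 \<le> a" "a < 1" for a x
  proof -
    have "\<bar>Q a x\<bar> \<le> (\<integral>z. D x z \<partial>lborel)"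
      unfolding Q_def by (rule integral_abs_bound_integral[OF Qint[OF that] Dint bd[OF that]])
    then show ?thesis unfolding D_def integral_mult_right_zero by (simp add: K_def mult_ac)
  qed
  have pint: "integrable \<mu> (\<lambda>x. K * (1 + norm x) ^ k)"
    using integrable_one_plus_norm_power[OF \<mu>(3,1,2), of k] by simp
  have Qmu: "integrable \<mu> (Q a)" if "0 \<le> a" "a < 1" for a
    by (rule Bochner_Integration.integrable_bound[OF pint Qm]) (use order_trans[OF Qbd[OF that] abs_ge_self] in auto)
  have g: "(\<integral>x. f x \<partial>gauss_measure) = (\<integral>z. gauss_dens z * f z \<partial>lborel)" by (rule integral_gauss_measure) measurable
  have gint: "integrable lborel (\<lambda>z. gauss_dens z * f z)"
    by (intro gauss_poly_integrable gauss_poly.dens poly_growth_imp_exp_growth[OF pg])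
  have le: "(\<integral>x. Q a x \<partial>\<mu>) - (\<integral>x. f x \<partial>gauss_measure) \<le> ?R" if a: "0 \<le> a" "a < 1" for a
  proof -
    \<comment> \<open>This closed form also settles the integrability that the Stein identity
      requires: the operator is Q_a f up to a constant.\<close>
    have eq: "x \<bullet> ou_field a f x - divergence (ou_field a f) x = Q a x - (\<integral>x. f x \<partial>gauss_measure)" for x
      unfolding stein_operator_ou_field[OF k f a] g Q_def using Qint[OF a] gint by (simp add: right_diff_distrib)
    show ?thesis
      using integral_ou_field_le[OF k \<mu>(1,2) f a mass \<tau> fin] Qmu[OF a] unfolding eq by (simp add: prob_space)
  qed
  \<comment> \<open>The previous bound is available only below 1, so the end point is approached
    along n / (n + 1).\<close>
  define b where "b n = real n / real (Suc n)" for n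
  have b: "0 \<le> b n" "b n < 1" for n by (auto simp: b_def)
  have blim: "b \<longlonglongrightarrow> 1" unfolding b_def by (rule LIMSEQ_n_over_Suc_n)
  have "(\<lambda>n. \<integral>x. Q (b n) x \<partial>\<mu>) \<longlonglongrightarrow> (\<integral>x. f x \<partial>\<mu>)"
  proof (rule integral_dominated_convergence[OF _ _ pint])
    show "AE x in \<mu>. (\<lambda>n. Q (b n) x) \<longlonglongrightarrow> f x"
    proof (rule AE_I2)
      fix x
      have "(\<lambda>n. Q (b n) x) \<longlonglongrightarrow> (\<integral>z. gauss_dens (z :: real^'n) * f x \<partial>lborel)"
        unfolding Q_def
      proof (rule integral_dominated_convergence[where w = "D x"])
        have "(\<lambda>n. b n *\<^sub>R x + sqrt (1 - (b n)\<^sup>2) *\<^sub>R z) \<longlonglongrightarrow> 1 *\<^sub>R x + sqrt (1 - 1\<^sup>2) *\<^sub>R z" for z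
          by (intro tendsto_intros blim)
        from continuous_on_tendsto_compose[OF fc this]
        have "(\<lambda>n. f (b n *\<^sub>R x + sqrt (1 - (b n)\<^sup>2) *\<^sub>R z)) \<longlonglongrightarrow> f x" for z by simp
        then show "AE z in lborel. (\<lambda>n. gauss_dens z * f (b n *\<^sub>R x + sqrt (1 - (b n)\<^sup>2) *\<^sub>R z)) \<longlonglongrightarrow> gauss_dens z * f x"
          by (intro AE_I2 tendsto_intros)
      qed (use bd[OF b] Dint[of x] in auto)
      then show "(\<lambda>n. Q (b n) x) \<longlonglongrightarrow> f x" by (simp add: mass)
    qed
  qed (use Qbd[OF b] in auto)
  then have "(\<lambda>n. (\<integral>x. Q (b n) x \<partial>\<mu>) - (\<integral>x. f x \<partial>gauss_measure)) \<longlonglongrightarrow> (\<integral>x. f x \<partial>\<mu>) - (\<integral>x. f x \<partial>gauss_measure)"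
    by (intro tendsto_intros)
  then show ?thesis by (rule LIMSEQ_le_const2) (use le[OF b] in auto)
qed

theorem theorem2p4:
  fixes \<mu> :: "(real^'n::finite) measure" and k :: nat
  assumes "k \<ge> 1"
    and "prob_space \<mu>"
    and "sets \<mu> = sets borel"
    and "moments_match (k + 1) \<mu>"
  shows "zol_dist k \<mu> gauss_measure \<le> stein_disc k \<mu>"
  unfolding zol_dist_def
proof (rule SUP_least, clarify)
  fix f :: "real^'n \<Rightarrow> real"
  assume f: "Ck k f" "\<forall>x. tnorm k (Dk_scalar k f x) \<le> 1"
  define L where "L = (\<integral>x. f x \<partial>\<mu>) - (\<integral>x. f x \<partial>gauss_measure)"
  \<comment> \<open>If the infimum is infinite, in particular if there is no Stein kernel, the
    discrepancy is infinite and the claim is trivial.\<close>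
  have "L \<le> sqrt (enn2real (stein_disc_sq k \<mu>))" if fin: "stein_disc_sq k \<mu> \<noteq> \<top>"
  proof (cases "L \<le> 0")
    case True
    then show ?thesis by (rule order_trans) simp
  next
    case False
    \<comment> \<open>The infimum runs over squared norms, so the bound for each kernel is squared
      before the infimum is taken; this is where L > 0 matters. A kernel with infinite integral
      satisfies the bound trivially.\<close>
    have "ennreal (L\<^sup>2) \<le> stein_disc_sq k \<mu>"
      unfolding stein_disc_sq_def
    proof (rule INF_greatest, clarify)
      fix \<tau> assume \<tau>: "stein_kernel k \<mu> \<tau>"
      let ?N = "\<integral>\<^sup>+ x. ennreal ((tnorm (k + 1) (\<tau> x))\<^sup>2) \<partial>\<mu>"
      show "ennreal (L\<^sup>2) \<le> ?N"
      proof (cases "?N < \<top>")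
        case fin: True
        have "L \<le> sqrt (enn2real ?N)"
          unfolding L_def using integral_diff_gauss_le[OF assms f(1) _ \<tau> fin] f(2) by blast
        then have "L\<^sup>2 \<le> enn2real ?N"
          using False by (metis enn2real_nonneg linear power_mono real_sqrt_pow2)
        then have "ennreal (L\<^sup>2) \<le> ennreal (enn2real ?N)" by (rule ennreal_leI)
        then show ?thesis using fin by (simp only: ennreal_enn2real)
      qed (metis top.not_eq_extremum top_greatest)
    qed
    then have "L\<^sup>2 \<le> enn2real (stein_disc_sq k \<mu>)"
      using fin by (metis enn2real_ennreal enn2real_mono less_top zero_le_power2)
    then show ?thesis by (rule real_le_rsqrt)
  qed
  then show "ereal ((\<integral>x. f x \<partial>\<mu>) - (\<integral>x. f x \<partial>gauss_measure)) \<le> stein_disc k \<mu>"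
    by (simp add: stein_disc_def L_def)
qed

end
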